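(* Let $0<\delta,\sigma\le1$, let $H\subset\mathbb{R}^2$ be measurable, let $u\colon\mathbb{R}\to\mathbb{R}$ be measurable, and let $\mathcal R$ be a finite collection of parallelograms with vertical edges whose shadows all belong to a single dyadic grid, such that for each $R\in\mathcal R$ $$|E(R)|\ge\delta|R|,\qquad |H\cap R|\ge\sigma|R|.$$ Then $$\Big|\bigcup_{R\in\mathcal R}R\Big|\lesssim\delta^{-1}\sigma^{-2}|H|,$$ with a universal implicit constant.
   Context: For a parallelogram $R$ with a pair of vertical edges: $I(R)$ (the shadow) is the projection of $R$ onto the $x$-axis, and $U(R)$ is the set of slopes of lines intersecting both vertical edges of $R$. Define $E(R)=\{(x,y)\in R: u(x)\in U(R)\}$. A dyadic grid means a collection of intervals of the form $[2^k(n+c_k),2^k(n+1+c_k))$, $k,n\in\mathbb Z$, with fixed shifts $c_k$, any two of which are disjoint or nested. $|\cdot|$ is Lebesgue measure. *)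

theory Defs
  imports "HOL-Analysis.Analysis"
begin

text \<open>A parallelogram with a pair of vertical edges is described by parameters
  (a, b, s, t, h) with a < b and h > 0: it is the closed set
  {(x,y). a \<le> x \<le> b, s*x + t \<le> y \<le> s*x + t + h}.
  Its vertical edges are {a} \<times> [s a + t, s a + t + h] and {b} \<times> [s b + t, s b + t + h].\<close>

datatype vpar = VPar (pa: real) (pb: real) (pslope: real) (pint: real) (pheight: real)

definition valid_vpar :: "vpar \<Rightarrow> bool" where
  "valid_vpar p \<longleftrightarrow> pa p < pb p \<and> 0 < pheight p"

definition par_set :: "vpar \<Rightarrow> (real \<times> real) set" where
  "par_set p = {(x, y). pa p \<le> x \<and> x \<le> pb p \<and>
       pslope p * x + pint p \<le> y \<and> y \<le> pslope p * x + pint p + pheight p}"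

definition left_edge :: "vpar \<Rightarrow> (real \<times> real) set" where
  "left_edge p = {(x, y). x = pa p \<and>
       pslope p * x + pint p \<le> y \<and> y \<le> pslope p * x + pint p + pheight p}"

definition right_edge :: "vpar \<Rightarrow> (real \<times> real) set" where
  "right_edge p = {(x, y). x = pb p \<and>
       pslope p * x + pint p \<le> y \<and> y \<le> pslope p * x + pint p + pheight p}"

definition shadow :: "vpar \<Rightarrow> real set" where
  "shadow p = fst ` par_set p"

definition Uset :: "vpar \<Rightarrow> real set" where
  "Uset p = {m. \<exists>q. (\<exists>y. (pa p, y) \<in> left_edge p \<and> y = m * pa p + q) \<and>
                     (\<exists>y. (pb p, y) \<in> right_edge p \<and> y = m * pb p + q)}"

definition Eset :: "(real \<Rightarrow> real) \<Rightarrow> vpar \<Rightarrow> (real \<times> real) set" where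
  "Eset u p = {(x, y) \<in> par_set p. u x \<in> Uset p}"

definition dint :: "(int \<Rightarrow> real) \<Rightarrow> int \<Rightarrow> int \<Rightarrow> real set" where
  "dint c k n = {2 powr (real_of_int k) * (real_of_int n + c k) ..<
                 2 powr (real_of_int k) * (real_of_int n + 1 + c k)}"

definition dyadic_grid :: "(int \<Rightarrow> real) \<Rightarrow> bool" where
  "dyadic_grid c \<longleftrightarrow> (\<forall>k n k' n'. dint c k n \<inter> dint c k' n' = {} \<or>
        dint c k n \<subseteq> dint c k' n' \<or> dint c k' n' \<subseteq> dint c k n)"

definition shadow_in_grid :: "(int \<Rightarrow> real) \<Rightarrow> vpar \<Rightarrow> bool" where
  "shadow_in_grid c p \<longleftrightarrow> (\<exists>k n. shadow p = closure (dint c k n))"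

end

theory Submission
  imports Defs
begin

text \<open>Run through the parallelograms by decreasing width and select one whenever it contains a point
  at which the vertical maximal function of the sum of the indicators of those selected before is
  small. The weak type (1,1) bound of that maximal function shows that the union has measure at most
  a constant times the sum \<open>S\<close> of the measures of the selected ones, and by Cauchy-Schwarz the claim
  follows once the sum of \<open>|R \<inter> R'|\<close> over selected pairs is at most a constant times \<open>S / \<delta>\<close>.

  If the slope intervals of a pair are close, fix the later member \<open>R'\<close>: sparseness bounds the total
  height of the earlier \<open>R\<close> near \<open>R'\<close> by the height of \<open>R'\<close>. Otherwise fix the earlier member
  \<open>R\<close> and group the later ones by the dyadic size \<open>v\<close> of the slope difference. Sparseness gives a
  Carleson type bound: over a grid interval \<open>T\<close> containing the base of some group member, the overlaps
  of \<open>R\<close> with the group add up to at most a constant times \<open>|T|\<close> times the height of \<open>R\<close>.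
  On a maximal base \<open>T\<close> of the group, \<open>u\<close> is at distance comparable to \<open>v\<close> from the slope of \<open>R\<close>
  on a set of measure at least \<open>\<delta> |T|\<close>, and these sets have bounded overlap as \<open>v\<close> varies.\<close>

section \<open>Strips and parallelograms\<close>

definition strip :: "real set \<Rightarrow> real \<Rightarrow> real \<Rightarrow> real \<Rightarrow> (real \<times> real) set" where
  "strip A s t h = {(x, y). x \<in> A \<and> s * x + t \<le> y \<and> y \<le> s * x + t + h}"

lemma par_set_eq_strip: "par_set p = strip {pa p..pb p} (pslope p) (pint p) (pheight p)"
  by (auto simp: par_set_def strip_def)

lemma strip_borel:
  assumes "A \<in> sets borel"
  shows "strip A s t h \<in> sets borel"
proof -
  have [measurable]: "A \<in> sets borel" by fact
  have "strip A s t h = {z \<in> space (borel \<Otimes>\<^sub>M borel). fst z \<in> A \<and> s * fst z + t \<le> snd z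
      \<and> snd z \<le> s * fst z + t + h}"
    by (auto simp: strip_def space_pair_measure)
  also have "\<dots> \<in> sets (borel \<Otimes>\<^sub>M borel)" by measurable
  finally show ?thesis by (simp only: borel_prod)
qed

text \<open>Fubini: every vertical fibre over a point of \<open>A\<close> is a segment of length
  \<open>h\<close>. A strip over a Borel set is Borel, so its Lebesgue measure is its product
  measure.\<close>

lemma emeasure_strip:
  assumes A: "A \<in> sets borel" and h: "0 \<le> h"
  shows "emeasure lebesgue (strip A s t h) = emeasure lborel A * ennreal h"
proof -
  have S: "strip A s t h \<in> sets (lborel \<Otimes>\<^sub>M lborel)"
    using strip_borel[OF A] by (simp only: lborel_prod sets_lborel)
  have fib: "emeasure lborel (Pair x -` strip A s t h) = ennreal h * indicator A x" for x
  proof (cases "x \<in> A")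
    case True
    then have "Pair x -` strip A s t h = {s * x + t..s * x + t + h}" by (auto simp: strip_def)
    then show ?thesis using True h by simp
  next
    case False
    then have "Pair x -` strip A s t h = {}" by (auto simp: strip_def)
    then show ?thesis using False by simp
  qed
  have "emeasure lebesgue (strip A s t h) = emeasure (lborel \<Otimes>\<^sub>M lborel) (strip A s t h)"
    using strip_borel[OF A] by (simp add: lborel_prod)
  also have "\<dots> = (\<integral>\<^sup>+ x. ennreal h * indicator A x \<partial>lborel)"
    using lborel.emeasure_pair_measure_alt[OF S] fib by simp
  also have "\<dots> = emeasure lborel A * ennreal h"
    using A by (simp add: nn_integral_cmult mult.commute)
  finally show ?thesis .
qed

lemma
  assumes A: "A \<in> sets borel" and fin: "emeasure lborel A < \<infinity>" and h: "0 \<le> h"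
  shows lmeasurable_strip: "strip A s t h \<in> lmeasurable"
    and measure_strip: "measure lebesgue (strip A s t h) = measure lborel A * h"
proof -
  show "strip A s t h \<in> lmeasurable"
    using emeasure_strip[OF A h] fin strip_borel[OF A]
    by (auto simp: fmeasurable_def ennreal_mult_less_top)
  show "measure lebesgue (strip A s t h) = measure lborel A * h"
    unfolding measure_def emeasure_strip[OF A h] using h by (simp add: enn2real_mult)
qed

text \<open>The vertical offset of the two strips is affine with slope \<open>s - s'\<close>, so
  their fibres meet only above an interval of length \<open>(h + h') / |s - s'|\<close>. The common
  fibres have height at most \<open>min h h'\<close>, and
  \<open>(h + h') * min h h' <= 2 * h * h'\<close>.\<close>

lemma measure_strip_Int_le:
  assumes A: "A \<in> sets borel" and fin: "emeasure lborel A < \<infinity>"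
    and h: "0 \<le> h" "0 \<le> h'" and ne: "s \<noteq> s'"
  shows "measure lebesgue (strip A s t h \<inter> strip A s' t' h') \<le> 2 * h * h' / \<bar>s - s'\<bar>"
proof -
  define d where "d = s - s'"
  define J where "J = {x. - h \<le> d * x + (t - t') \<and> d * x + (t - t') \<le> h'}"
  have d0: "d \<noteq> 0" using ne by (simp add: d_def)
  have J: "J \<in> sets borel \<and> measure lborel J = (h + h') / \<bar>d\<bar> \<and> emeasure lborel J < \<infinity>"
  proof (cases "d > 0")
    case True
    have "J = {(- h - (t - t')) / d .. (h' - (t - t')) / d}"
      using True by (auto simp: J_def field_simps)
    moreover have "(- h - (t - t')) / d \<le> (h' - (t - t')) / d"
      using True h by (simp add: divide_right_mono)
    ultimately show ?thesis using True by (auto simp: field_simps)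
  next
    case False
    then have dn: "d < 0" using d0 by simp
    have "J = {(h' - (t - t')) / d .. (- h - (t - t')) / d}"
      using dn by (auto simp: J_def field_simps)
    moreover have "(h' - (t - t')) / d \<le> (- h - (t - t')) / d"
      using dn h by (intro divide_right_mono_neg) auto
    ultimately show ?thesis using dn by (auto simp: field_simps)
  qed
  have sub: "strip A s t h \<inter> strip A s' t' h' \<subseteq> strip J s t h"
    "strip A s t h \<inter> strip A s' t' h' \<subseteq> strip J s' t' h'"
    by (auto simp: strip_def J_def d_def algebra_simps)
  have m: "strip A s t h \<inter> strip A s' t' h' \<in> sets lebesgue"
    using strip_borel[OF A] by auto
  have le1: "measure lebesgue (strip A s t h \<inter> strip A s' t' h') \<le> (h + h') / \<bar>d\<bar> * h"
    using measure_mono_fmeasurable[OF sub(1) m lmeasurable_strip] measure_strip J h by metis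
  have le2: "measure lebesgue (strip A s t h \<inter> strip A s' t' h') \<le> (h + h') / \<bar>d\<bar> * h'"
    using measure_mono_fmeasurable[OF sub(2) m lmeasurable_strip] measure_strip J h by metis
  have "(h + h') * min h h' \<le> 2 * h * h'"
  proof (cases "h \<le> h'")
    case True
    then have "h * h \<le> h * h'" using h by (intro mult_left_mono) auto
    then show ?thesis using True by (simp add: algebra_simps)
  next
    case False
    then have "h' * h' \<le> h * h'" using h by (intro mult_right_mono) auto
    then show ?thesis using False by (simp add: algebra_simps)
  qed
  then have "(h + h') / \<bar>d\<bar> * min h h' \<le> 2 * h * h' / \<bar>d\<bar>"
    by (simp add: divide_right_mono)
  then show ?thesis using le1 le2 unfolding d_def by (auto simp: min_def split: if_splits)
qed

section \<open>Half-open parallelograms and their slope intervals\<close>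

definition base :: "vpar \<Rightarrow> real set" where
  "base p = {pa p..<pb p}"

definition wid :: "vpar \<Rightarrow> real" where
  "wid p = pb p - pa p"

text \<open>The half-open bases are themselves members of the grid, unlike the closed shadows, which may
  meet in an endpoint.\<close>

definition hpar :: "vpar \<Rightarrow> (real \<times> real) set" where
  "hpar p = strip (base p) (pslope p) (pint p) (pheight p)"

definition bot :: "vpar \<Rightarrow> real \<Rightarrow> real" where
  "bot p x = pslope p * x + pint p"

lemma base_borel [simp]: "base p \<in> sets borel" "emeasure lborel (base p) < top"
  unfolding base_def by (cases "pa p \<le> pb p"; simp)+

lemma mem_hpar: "(x, y) \<in> hpar p \<longleftrightarrow> x \<in> base p \<and> bot p x \<le> y \<and> y \<le> bot p x + pheight p"
  by (simp add: hpar_def strip_def bot_def)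

lemma valid_vparD: "valid_vpar p \<Longrightarrow> pa p < pb p \<and> 0 < wid p \<and> 0 < pheight p"
  by (simp add: valid_vpar_def wid_def)

lemma measure_base: "valid_vpar p \<Longrightarrow> measure lborel (base p) = wid p"
  by (simp add: base_def wid_def valid_vpar_def)

lemma hpar_borel: "hpar p \<in> sets borel"
  unfolding hpar_def by (rule strip_borel) simp

lemma hpar_lmeasurable: "valid_vpar p \<Longrightarrow> hpar p \<in> lmeasurable"
  unfolding hpar_def using valid_vparD[of p] by (intro lmeasurable_strip) auto

lemma measure_hpar: "valid_vpar p \<Longrightarrow> measure lebesgue (hpar p) = wid p * pheight p"
  unfolding hpar_def using valid_vparD[of p] by (subst measure_strip) (auto simp: measure_base)

lemma measure_par_set: "valid_vpar p \<Longrightarrow> measure lebesgue (par_set p) = wid p * pheight p"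
  unfolding par_set_eq_strip using valid_vparD[of p] by (subst measure_strip) (auto simp: wid_def)

lemma par_set_lmeasurable: "valid_vpar p \<Longrightarrow> par_set p \<in> lmeasurable"
  unfolding par_set_eq_strip using valid_vparD[of p] by (intro lmeasurable_strip) auto

lemma hpar_subset_par_set: "hpar p \<subseteq> par_set p"
  by (auto simp: hpar_def par_set_eq_strip strip_def base_def)

lemma par_set_Diff_hpar_null:
  assumes "valid_vpar p"
  shows "par_set p - hpar p \<in> null_sets lebesgue"
proof -
  have "measure lebesgue (par_set p - hpar p) = 0"
    using measurable_measure_Diff[OF par_set_lmeasurable[OF assms] _ hpar_subset_par_set]
      measure_par_set[OF assms] measure_hpar[OF assms] hpar_lmeasurable[OF assms] by auto
  moreover have "par_set p - hpar p \<in> lmeasurable"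
    using par_set_lmeasurable[OF assms] hpar_lmeasurable[OF assms] by (simp add: fmeasurable_Diff)
  ultimately show ?thesis by (auto simp: null_sets_def emeasure_eq_measure2)
qed

text \<open>Subtracting the edge conditions at the two ends shows that over the whole width the line
  drifts by at most one height relative to the bottom edge.\<close>

lemma Uset_bound:
  assumes "valid_vpar p" "m \<in> Uset p"
  shows "\<bar>m - pslope p\<bar> \<le> pheight p / wid p"
proof -
  note v = valid_vparD[OF assms(1)]
  from assms(2) obtain q where
    q: "pslope p * pa p + pint p \<le> m * pa p + q" "m * pa p + q \<le> pslope p * pa p + pint p + pheight p"
       "pslope p * pb p + pint p \<le> m * pb p + q" "m * pb p + q \<le> pslope p * pb p + pint p + pheight p"
    by (auto simp: Uset_def left_edge_def right_edge_def)
  have "\<bar>(m - pslope p) * wid p\<bar> \<le> pheight p"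
    using q by (simp add: wid_def abs_le_iff algebra_simps)
  then show ?thesis using v by (simp add: abs_mult pos_le_divide_eq)
qed

section \<open>Dyadic intervals\<close>

lemma dint_eq: "dint c k n = {2 powr k * (n + c k) ..< 2 powr k * (n + c k) + 2 powr k}"
  by (simp add: dint_def algebra_simps)

lemma base_in_grid:
  assumes "valid_vpar p" "shadow_in_grid c p"
  shows "\<exists>k n. base p = dint c k n"
proof -
  from assms(2) obtain k n where kn: "shadow p = closure (dint c k n)"
    by (auto simp: shadow_in_grid_def)
  define l where "l = 2 powr k * (n + c k)"
  note v = valid_vparD[OF assms(1)]
  have "shadow p = {pa p..pb p}"
  proof -
    have "x \<in> fst ` par_set p" if "pa p \<le> x" "x \<le> pb p" for x
      using that v by (intro image_eqI[of _ _ "(x, bot p x)"]) (auto simp: par_set_def bot_def)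
    then show ?thesis by (auto simp: shadow_def par_set_def)
  qed
  moreover have "closure (dint c k n) = {l..l + 2 powr k}"
    unfolding dint_eq l_def[symmetric] by (rule closure_atLeastLessThan) simp
  ultimately have "pa p = l \<and> pb p = l + 2 powr k"
    using kn v by (simp add: Icc_eq_Icc)
  then show ?thesis unfolding base_def dint_eq l_def by auto
qed

text \<open>The shifts at consecutive scales are related only through nestedness. The interval of
  scale \<open>k - 1\<close> containing the left endpoint \<open>a\<close> is too short to contain
  the parent, so it lies inside it and must begin at \<open>a\<close>; its right neighbour is the
  other half.\<close>

lemma dyadic_halves:
  assumes g: "dyadic_grid c"
  obtains m where "dint c k n = dint c (k - 1) m \<union> dint c (k - 1) (m + 1)"
    "dint c (k - 1) m \<inter> dint c (k - 1) (m + 1) = {}"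
proof -
  define a where "a = 2 powr k * (n + c k)"
  define e where "e = (2::real) powr (k - 1)"
  have e: "e > 0" "2 powr k = 2 * e" "2 powr (real_of_int k - 1) = e"
    by (simp_all add: e_def powr_diff)
  define m where "m = \<lfloor>a / e - c (k - 1)\<rfloor>"
  define b where "b = e * (m + c (k - 1))"
  have D: "dint c k n = {a..<a + 2 * e}" "dint c (k - 1) m = {b..<b + e}"
     "dint c (k - 1) (m + 1) = {b + e..<b + 2 * e}"
    unfolding dint_eq by (simp_all add: a_def b_def e(2,3) algebra_simps)
  have "m \<le> a / e - c (k - 1)" "a / e - c (k - 1) < m + 1"
    unfolding m_def by linarith+
  then have b1: "b \<le> a" "a < b + e" using e(1) by (simp_all add: b_def field_simps)
  have "{a..<a + 2 * e} \<inter> {b..<b + e} = {} \<or> {a..<a + 2 * e} \<subseteq> {b..<b + e} \<or> {b..<b + e} \<subseteq> {a..<a + 2 * e}"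
    using g D unfolding dyadic_grid_def by metis
  moreover have "a \<in> {a..<a + 2 * e} \<inter> {b..<b + e}" using b1 e by simp
  moreover have "\<not> {a..<a + 2 * e} \<subseteq> {b..<b + e}" using e b1 by (auto simp: ivl_subset)
  ultimately have "{b..<b + e} \<subseteq> {a..<a + 2 * e}" by blast
  then have "a \<le> b" using e by (auto simp: ivl_subset)
  then have "a = b" using b1 by simp
  moreover have "{b..<b + 2 * e} = {b..<b + e} \<union> {b + e..<b + 2 * e}" using e(1) by auto
  moreover have "{b..<b + e} \<inter> {b + e..<b + 2 * e} = {}" by auto
  ultimately show ?thesis using that[of m] D by metis
qed

section \<open>Greedy selection and the vertical maximal function\<close>

definition slice :: "vpar \<Rightarrow> real \<Rightarrow> real set" where
  "slice p x = {y. (x, y) \<in> hpar p}"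

definition load :: "vpar \<Rightarrow> real \<Rightarrow> real \<Rightarrow> real \<Rightarrow> real" where
  "load p x y r = measure lborel (slice p x \<inter> ball y r)"

lemma slice_eq: "slice p x = (if x \<in> base p then {bot p x..bot p x + pheight p} else {})"
  by (auto simp: slice_def mem_hpar)

lemma slice_lmeasurable [simp]: "slice p x \<in> fmeasurable lborel"
  by (cases "0 \<le> pheight p") (auto simp: slice_eq fmeasurable_def)

lemma load_nonneg: "0 \<le> load p x y r"
  by (simp add: load_def)

text \<open>The ball of radius \<open>2 * \<rho>\<close> about \<open>y\<close> contains the one of
  radius \<open>\<rho>\<close> about \<open>z\<close>. A segment of length \<open>pheight p\<close>
  through \<open>z\<close> has length at least \<open>min (pheight p) \<rho>\<close> inside the
  latter.\<close>

lemma load_ge: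
  assumes p: "valid_vpar p" and x: "x \<in> base p" and z: "z \<in> slice p x" "\<bar>z - y\<bar> \<le> \<rho>"
  shows "min (pheight p) \<rho> \<le> load p x y (2 * \<rho>)"
proof (cases "\<rho> = 0")
  case True
  then show ?thesis using load_nonneg[of p x y "2 * \<rho>"] by auto
next
  case False
  then have \<rho>: "\<rho> > 0" using z by auto
  note v = valid_vparD[OF p]
  define b where "b = bot p x"
  define l where "l = max b (y - 2 * \<rho>)"
  define u where "u = min (b + pheight p) (y + 2 * \<rho>)"
  have zb: "b \<le> z" "z \<le> b + pheight p" using z x by (auto simp: slice_eq b_def)
  have le: "min (pheight p) \<rho> \<le> u - l" using z zb \<rho> v by (auto simp: l_def u_def abs_le_iff)
  have "{l<..<u} \<subseteq> slice p x \<inter> ball y (2 * \<rho>)"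
    using x by (auto simp: slice_eq b_def l_def u_def dist_real_def)
  then have "measure lborel {l<..<u} \<le> load p x y (2 * \<rho>)"
    unfolding load_def by (intro measure_mono_fmeasurable fmeasurable_Int_fmeasurable) auto
  moreover have "l \<le> u" using le v \<rho> by auto
  ultimately show ?thesis using le by simp
qed

text \<open>The vertical maximal function of the first \<open>i\<close> selected parallelograms is small at \<open>(x, y)\<close>.\<close>

definition sparse_at :: "vpar list \<Rightarrow> nat \<Rightarrow> real \<Rightarrow> real \<Rightarrow> bool" where
  "sparse_at gs i x y \<longleftrightarrow> (\<forall>r>0. (\<Sum>j<i. load (gs ! j) x y r) < r / 10)"

text \<open>The ranking induction inserts the parallelograms by decreasing width and appends one to
  the list when it has a sparse point. Loads only grow with the list, so a point where sparseness
  has failed stays bad; this gives the last clause for the rejected parallelograms too.\<close>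

lemma greedy_selection:
  assumes "finite F" "\<And>p. p \<in> F \<Longrightarrow> valid_vpar p"
  shows "\<exists>gs. set gs \<subseteq> F \<and> sorted_wrt (\<lambda>p q. wid q \<le> wid p) gs \<and>
     (\<forall>i<length gs. \<exists>x y. (x, y) \<in> hpar (gs ! i) \<and> sparse_at gs i x y) \<and>
     (\<forall>p\<in>F. \<forall>x y. (x, y) \<in> hpar p \<longrightarrow> \<not> sparse_at gs (length gs) x y)"
  using assms
proof (induction F rule: finite_ranking_induct[where f = "\<lambda>p. - wid p"])
  case empty
  then show ?case by auto
next
  case (insert p F)
  then obtain gs where gs: "set gs \<subseteq> F" "sorted_wrt (\<lambda>p q. wid q \<le> wid p) gs"
     "\<And>i. i < length gs \<Longrightarrow> \<exists>x y. (x, y) \<in> hpar (gs ! i) \<and> sparse_at gs i x y"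
     "\<And>p x y. p \<in> F \<Longrightarrow> (x, y) \<in> hpar p \<Longrightarrow> \<not> sparse_at gs (length gs) x y"
    by (metis insertI2)
  show ?case
  proof (cases "\<exists>x y. (x, y) \<in> hpar p \<and> sparse_at gs (length gs) x y")
    case False
    then show ?thesis using gs by (intro exI[of _ gs]) auto
  next
    case True
    have same: "sparse_at (gs @ [p]) i x y \<longleftrightarrow> sparse_at gs i x y" if "i \<le> length gs" for i x y
      using that by (simp add: sparse_at_def nth_append)
    have split: "(\<Sum>j<length (gs @ [p]). load ((gs @ [p]) ! j) x y r) =
        (\<Sum>j<length gs. load (gs ! j) x y r) + load p x y r" for x y r
      by (simp add: nth_append)
    have "\<not> sparse_at (gs @ [p]) (length (gs @ [p])) x y" if "q \<in> insert p F" "(x, y) \<in> hpar q" for q x y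
    proof (cases "q = p")
      case True
      define h where "h = pheight p"
      have h: "h > 0" using valid_vparD[of p] insert.prems h_def by auto
      have "min h h \<le> load p x y (2 * h)"
        unfolding h_def using insert.prems that True valid_vparD[of p]
        by (intro load_ge[where z = y]) (auto simp: slice_def mem_hpar)
      moreover have "0 \<le> (\<Sum>j<length gs. load (gs ! j) x y (2 * h))"
        by (intro sum_nonneg load_nonneg)
      ultimately have "(\<Sum>j<length (gs @ [p]). load ((gs @ [p]) ! j) x y (2 * h)) \<ge> 2 * h / 10"
        unfolding split using h by simp
      then show ?thesis using h unfolding sparse_at_def
        by (intro notI) (drule spec[of _ "2 * h"], simp)
    next
      case False
      then have "\<not> sparse_at gs (length gs) x y" using gs(4) that by auto
      then obtain r where r: "r > 0" "r / 10 \<le> (\<Sum>j<length gs. load (gs ! j) x y r)"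
        by (auto simp: sparse_at_def not_less)
      then have "r / 10 \<le> (\<Sum>j<length (gs @ [p]). load ((gs @ [p]) ! j) x y r)"
        unfolding split using load_nonneg[of p x y r] by simp
      then show ?thesis using r(1) unfolding sparse_at_def by (meson not_less)
    qed
    moreover have "\<exists>x y. (x, y) \<in> hpar ((gs @ [p]) ! i) \<and> sparse_at (gs @ [p]) i x y"
      if "i < length (gs @ [p])" for i
    proof (cases "i < length gs")
      case True
      then show ?thesis using gs(3)[of i] same[of i] by (simp add: nth_append)
    next
      case False
      then have "i = length gs" using that by simp
      then show ?thesis using \<open>\<exists>x y. _ \<and> _\<close> same[of i] by (simp add: nth_append)
    qed
    moreover have "sorted_wrt (\<lambda>p q. wid q \<le> wid p) (gs @ [p])"
      using gs(1,2) insert.hyps by (auto simp: sorted_wrt_append)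
    ultimately show ?thesis using gs(1) by (intro exI[of _ "gs @ [p]"]) auto
  qed
qed

text \<open>Vitali covering on a vertical line. Each point of the union has a ball with load at
  least a tenth of its radius; disjoint balls among these, enlarged five times, still cover. An
  enlarged ball has length \<open>10 * r\<close>, at most \<open>100\<close> times the load, and the
  loads of one slice in disjoint balls add up to at most its length.\<close>

lemma weak_type_line:
  assumes F: "finite F" and v: "\<And>p. p \<in> set gs \<Longrightarrow> valid_vpar p"
    and ns: "\<And>p y. p \<in> F \<Longrightarrow> (x, y) \<in> hpar p \<Longrightarrow> \<not> sparse_at gs (length gs) x y"
  shows "emeasure lborel (\<Union>p\<in>F. slice p x)
    \<le> ennreal (\<Sum>i<length gs. 100 * pheight (gs ! i) * indicator (base (gs ! i)) x)"
proof -
  define S where "S = (\<Union>p\<in>F. slice p x)"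
  define n where "n = length gs"
  define m where "m i = measure lborel (slice (gs ! i) x)" for i
  have S: "compact S" unfolding S_def using F by (intro compact_UN) (auto simp: slice_eq)
  have "\<exists>r. r > 0 \<and> r / 10 \<le> (\<Sum>i<n. load (gs ! i) x y r)" if "y \<in> S" for y
  proof -
    obtain p where "p \<in> F" "(x, y) \<in> hpar p" using \<open>y \<in> S\<close> by (auto simp: S_def slice_def)
    then show ?thesis using ns[of p y] by (auto simp: sparse_at_def not_less n_def)
  qed
  then have "\<forall>y\<in>S. \<exists>r. r > 0 \<and> r / 10 \<le> (\<Sum>i<n. load (gs ! i) x y r)" by blast
  from bchoice[OF this] obtain r
    where "\<forall>y\<in>S. r y > 0 \<and> r y / 10 \<le> (\<Sum>i<n. load (gs ! i) x y (r y))" ..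
  then have r: "r y > 0" "r y / 10 \<le> (\<Sum>i<n. load (gs ! i) x y (r y))" if "y \<in> S" for y
    using that by simp_all
  have cov: "S \<subseteq> (\<Union>y\<in>S. ball y (r y))" using r(1) by force
  \<comment> \<open>Compactness reduces to finitely many balls, so that the radii are bounded as the
    covering lemma requires.\<close>
  obtain K where K: "K \<subseteq> S" "finite K" "S \<subseteq> (\<Union>y\<in>K. ball y (r y))"
    using compactE_image[OF S _ cov] by auto
  obtain C where C: "C \<subseteq> K" "pairwise (\<lambda>y y'. disjnt (ball y (r y)) (ball y' (r y'))) C"
     "S \<subseteq> (\<Union>y\<in>C. ball y (5 * r y))"
  proof (rule Vitali_covering_lemma_balls[OF K(3), of "Max (insert 0 (r ` K))"])
    show "\<And>y. y \<in> K \<Longrightarrow> 0 < r y \<and> r y \<le> Max (insert 0 (r ` K))"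
      using K r(1) by auto
  qed (use that in blast)
  have fC: "finite C" using C K finite_subset by blast
  have CS: "\<And>y. y \<in> C \<Longrightarrow> y \<in> S" using C K by auto
  have bm: "ball y \<rho> \<in> fmeasurable lborel" for y \<rho> :: real
    by (cases "0 \<le> \<rho>") (auto simp: ball_eq_greaterThanLessThan fmeasurable_def)
  have "measure lborel S \<le> measure lborel (\<Union>y\<in>C. ball y (5 * r y))"
    using S C(3) fC bm by (intro measure_mono_fmeasurable fmeasurable.finite_UN) (auto simp: borel_compact)
  also have "\<dots> \<le> (\<Sum>y\<in>C. measure lborel (ball y (5 * r y)))"
    using fC by (intro measure_UNION_le) auto
  also have "\<dots> = (\<Sum>y\<in>C. 10 * r y)"
    using r(1) CS by (intro sum.cong refl) (force simp: ball_eq_greaterThanLessThan intro!: less_imp_le)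
  also have "\<dots> \<le> (\<Sum>y\<in>C. 100 * (\<Sum>i<n. load (gs ! i) x y (r y)))"
    using r(2) CS by (intro sum_mono) force
  also have "\<dots> = (\<Sum>i<n. 100 * (\<Sum>y\<in>C. load (gs ! i) x y (r y)))"
    by (simp add: sum_distrib_left sum.swap[of _ C])
  also have "\<dots> \<le> (\<Sum>i<n. 100 * m i)"
  proof (intro sum_mono mult_left_mono)
    fix i
    have sl: "slice (gs ! i) x \<inter> ball y (r y) \<in> fmeasurable lborel" for y
      by (rule fmeasurable_Int_fmeasurable) auto
    have "(\<Sum>y\<in>C. load (gs ! i) x y (r y)) = measure lborel (\<Union>y\<in>C. slice (gs ! i) x \<inter> ball y (r y))"
      unfolding load_def
    proof (rule measure_finite_Union[symmetric])
      show "disjoint_family_on (\<lambda>y. slice (gs ! i) x \<inter> ball y (r y)) C"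
        using C(2) unfolding disjoint_family_on_def pairwise_def disjnt_def by blast
      show "(\<lambda>y. slice (gs ! i) x \<inter> ball y (r y)) ` C \<subseteq> sets lborel"
        using fmeasurableD[OF sl] by auto
      show "emeasure lborel (slice (gs ! i) x \<inter> ball y (r y)) \<noteq> \<infinity>" for y
        using fmeasurableD2[OF sl] by simp
    qed fact
    also have "\<dots> \<le> m i"
      unfolding m_def using fC fmeasurableD[OF sl]
      by (intro measure_mono_fmeasurable sets.finite_UN) auto
    finally show "(\<Sum>y\<in>C. load (gs ! i) x y (r y)) \<le> m i" .
  qed simp
  also have "\<dots> = (\<Sum>i<n. 100 * pheight (gs ! i) * indicator (base (gs ! i)) x)"
    using v[OF nth_mem] valid_vparD by (intro sum.cong refl) (force simp: m_def slice_eq n_def less_imp_le)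
  finally have "measure lborel S \<le> (\<Sum>i<n. 100 * pheight (gs ! i) * indicator (base (gs ! i)) x)" .
  moreover have "emeasure lborel S = ennreal (measure lborel S)"
    using S by (intro emeasure_eq_ennreal_measure) (use emeasure_compact_finite in force)
  ultimately show ?thesis unfolding S_def n_def by (simp add: ennreal_leI)
qed

text \<open>Integrates the bound on vertical lines. Closed and half-open parallelograms differ by
  null sets, so the union may be taken over the latter.\<close>

lemma weak_type:
  assumes F: "finite F" "\<And>p. p \<in> F \<Longrightarrow> valid_vpar p" and v: "\<And>p. p \<in> set gs \<Longrightarrow> valid_vpar p"
    and ns: "\<And>p x y. p \<in> F \<Longrightarrow> (x, y) \<in> hpar p \<Longrightarrow> \<not> sparse_at gs (length gs) x y"
  shows "emeasure lebesgue (\<Union>p\<in>F. par_set p)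
    \<le> ennreal (100 * (\<Sum>i<length gs. measure lebesgue (hpar (gs ! i))))"
proof -
  have hl: "hpar p \<in> sets lebesgue" for p using hpar_borel by simp
  have B: "(\<Union>p\<in>F. hpar p) \<in> sets borel" using F hpar_borel by auto
  then have B': "(\<Union>p\<in>F. hpar p) \<in> sets (lborel \<Otimes>\<^sub>M lborel)"
    by (simp only: lborel_prod sets_lborel)
  have ps: "par_set p \<in> sets lebesgue" if "p \<in> F" for p
    using par_set_lmeasurable F(2) that by blast
  have "emeasure lebesgue (\<Union>p\<in>F. par_set p) \<le> emeasure lebesgue ((\<Union>p\<in>F. hpar p) \<union> (\<Union>p\<in>F. par_set p - hpar p))"
    using F ps hl by (intro emeasure_mono sets.Un sets.finite_UN sets.Diff) auto
  also have "\<dots> = emeasure lebesgue (\<Union>p\<in>F. hpar p)"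
    using F B par_set_Diff_hpar_null by (intro emeasure_Un_null_set null_sets_UN' countable_finite) auto
  also have "\<dots> = emeasure (lborel \<Otimes>\<^sub>M lborel) (\<Union>p\<in>F. hpar p)"
    using B by (simp add: lborel_prod)
  also have "\<dots> = (\<integral>\<^sup>+ x. emeasure lborel (Pair x -` (\<Union>p\<in>F. hpar p)) \<partial>lborel)"
    by (rule lborel.emeasure_pair_measure_alt[OF B'])
  also have "\<dots> \<le> (\<integral>\<^sup>+ x. ennreal (\<Sum>i<length gs. 100 * pheight (gs ! i) * indicator (base (gs ! i)) x) \<partial>lborel)"
  proof (rule nn_integral_mono)
    fix x
    have "Pair x -` (\<Union>p\<in>F. hpar p) = (\<Union>p\<in>F. slice p x)" by (auto simp: slice_def)
    then show "emeasure lborel (Pair x -` (\<Union>p\<in>F. hpar p))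
      \<le> ennreal (\<Sum>i<length gs. 100 * pheight (gs ! i) * indicator (base (gs ! i)) x)"
      using weak_type_line[OF F(1) v ns] by simp
  qed
  also have "\<dots> = (\<integral>\<^sup>+ x. (\<Sum>i<length gs. ennreal (100 * pheight (gs ! i)) * indicator (base (gs ! i)) x) \<partial>lborel)"
  proof (rule nn_integral_cong)
    fix x
    have "ennreal (\<Sum>i<length gs. 100 * pheight (gs ! i) * indicator (base (gs ! i)) x)
      = (\<Sum>i<length gs. ennreal (100 * pheight (gs ! i) * indicator (base (gs ! i)) x))"
      using v[OF nth_mem] valid_vparD by (intro sum_ennreal[symmetric]) (force simp: less_imp_le)
    also have "\<dots> = (\<Sum>i<length gs. ennreal (100 * pheight (gs ! i)) * indicator (base (gs ! i)) x)"
      by (intro sum.cong refl) (auto split: split_indicator)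
    finally show "ennreal (\<Sum>i<length gs. 100 * pheight (gs ! i) * indicator (base (gs ! i)) x) = \<dots>" .
  qed
  also have "\<dots> = (\<Sum>i<length gs. ennreal (100 * pheight (gs ! i)) * emeasure lborel (base (gs ! i)))"
    by (subst nn_integral_sum)
      (simp_all add: nn_integral_cmult_indicator borel_measurable_times_ennreal borel_measurable_indicator)
  also have "\<dots> = (\<Sum>i<length gs. ennreal (100 * measure lebesgue (hpar (gs ! i))))"
  proof (intro sum.cong refl)
    fix i assume "i \<in> {..<length gs}"
    then have vi: "valid_vpar (gs ! i)" using v[OF nth_mem] by simp
    have "emeasure lborel (base (gs ! i)) = ennreal (wid (gs ! i))"
      using valid_vparD[OF vi] by (simp add: base_def wid_def)
    then show "ennreal (100 * pheight (gs ! i)) * emeasure lborel (base (gs ! i)) =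
        ennreal (100 * measure lebesgue (hpar (gs ! i)))"
      using measure_hpar[OF vi] valid_vparD[OF vi] by (simp add: ennreal_mult[symmetric] mult_ac)
  qed
  also have "\<dots> = ennreal (100 * (\<Sum>i<length gs. measure lebesgue (hpar (gs ! i))))"
    by (subst sum_ennreal) (auto simp: sum_distrib_left)
  finally show ?thesis .
qed

section \<open>Overlaps of selected parallelograms\<close>

text \<open>The witness is \<open>y\<close> clamped to the segment.\<close>

lemma slice_near:
  assumes "x \<in> base p" "0 \<le> pheight p" "0 \<le> \<rho>" "bot p x \<le> y + \<rho>" "y \<le> bot p x + pheight p + \<rho>"
  shows "\<exists>z\<in>slice p x. \<bar>z - y\<bar> \<le> \<rho>"
  using assms by (intro bexI[of _ "max (bot p x) (min y (bot p x + pheight p))"]) (auto simp: slice_eq)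

lemma hpar_meet:
  assumes "(x, y) \<in> hpar p" "(x, y) \<in> hpar q"
  shows "- pheight p \<le> bot p x - bot q x" "bot p x - bot q x \<le> pheight q"
  using assms by (auto simp: mem_hpar)

text \<open>The offset of two bottom edges is affine, with the difference of the slopes as its
  slope. This carries information from a meeting point of two parallelograms to the abscissa of a
  sparse point.\<close>

lemma bot_drift: "\<bar>x - z\<bar> \<le> L \<Longrightarrow> \<bar>pslope p - pslope q\<bar> \<le> m \<Longrightarrow>
    \<bar>(bot p x - bot q x) - (bot p z - bot q z)\<bar> \<le> m * L"
proof -
  assume a: "\<bar>x - z\<bar> \<le> L" "\<bar>pslope p - pslope q\<bar> \<le> m"
  have "(bot p x - bot q x) - (bot p z - bot q z) = (pslope p - pslope q) * (x - z)"
    by (simp add: bot_def algebra_simps)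
  then show ?thesis using mult_mono[OF a(2,1)] a by (simp add: abs_mult)
qed

text \<open>Localised to \<open>T\<close> so that overlaps can be divided between the halves of a
  dyadic interval.\<close>

definition ovl :: "vpar \<Rightarrow> vpar \<Rightarrow> real set \<Rightarrow> real" where
  "ovl p q T = measure lebesgue (hpar p \<inter> hpar q \<inter> T \<times> UNIV)"

lemma Times_UNIV_borel: "T \<in> sets borel \<Longrightarrow> T \<times> (UNIV :: real set) \<in> sets borel"
  for T :: "real set"
  by (subst borel_prod[symmetric]) (simp add: pair_measureI)

lemma ovl_le_strip:
  assumes q: "valid_vpar q" and T: "T \<in> sets borel" "emeasure lborel T < top"
  shows "ovl p q T \<le> measure lborel T * pheight q"
proof -
  have sub: "hpar p \<inter> hpar q \<inter> T \<times> UNIV \<subseteq> strip T (pslope q) (pint q) (pheight q)"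
    by (auto simp: hpar_def strip_def)
  have "hpar p \<inter> hpar q \<inter> T \<times> UNIV \<in> sets lebesgue"
    using hpar_borel Times_UNIV_borel[OF T(1)] by auto
  then have "ovl p q T \<le> measure lebesgue (strip T (pslope q) (pint q) (pheight q))"
    unfolding ovl_def using valid_vparD[OF q] T
    by (intro measure_mono_fmeasurable[OF sub] lmeasurable_strip) auto
  then show ?thesis using valid_vparD[OF q] T by (simp add: measure_strip)
qed

text \<open>Unlike in \<open>ovl_le_strip\<close>, the bound does not depend on the length of
  \<open>T\<close>; it serves pairs with separated slopes.\<close>

lemma ovl_le_transversal:
  assumes v: "valid_vpar p" "valid_vpar q" and T: "T \<in> sets borel" "emeasure lborel T < top"
    and ne: "0 < d" "d \<le> \<bar>pslope p - pslope q\<bar>"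
  shows "ovl p q T \<le> 2 * pheight p * pheight q / d"
proof -
  note vv = valid_vparD[OF v(1)] valid_vparD[OF v(2)]
  let ?S = "strip T (pslope p) (pint p) (pheight p) \<inter> strip T (pslope q) (pint q) (pheight q)"
  have sub: "hpar p \<inter> hpar q \<inter> T \<times> UNIV \<subseteq> ?S"
    by (auto simp: hpar_def strip_def)
  have "hpar p \<inter> hpar q \<inter> T \<times> UNIV \<in> sets lebesgue"
    using hpar_borel Times_UNIV_borel[OF T(1)] by auto
  then have "ovl p q T \<le> measure lebesgue ?S"
    unfolding ovl_def using vv T
    by (intro measure_mono_fmeasurable[OF sub] fmeasurable.Int lmeasurable_strip) auto
  also have "\<dots> \<le> 2 * pheight p * pheight q / \<bar>pslope p - pslope q\<bar>"
    using vv T ne by (intro measure_strip_Int_le) auto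
  also have "\<dots> \<le> 2 * pheight p * pheight q / d"
    using vv ne by (intro divide_left_mono) auto
  finally show ?thesis .
qed

lemma ovl_Un_le:
  assumes "S \<in> sets borel" "T \<in> sets borel"
  shows "ovl p q (S \<union> T) \<le> ovl p q S + ovl p q T"
proof -
  have "hpar p \<inter> hpar q \<inter> (S \<union> T) \<times> UNIV = hpar p \<inter> hpar q \<inter> S \<times> UNIV \<union> hpar p \<inter> hpar q \<inter> T \<times> UNIV"
    by auto
  then show ?thesis unfolding ovl_def
    using measure_Un_le[of "hpar p \<inter> hpar q \<inter> S \<times> UNIV" lebesgue "hpar p \<inter> hpar q \<inter> T \<times> UNIV"]
      hpar_borel Times_UNIV_borel assms by auto
qed

lemma ovl_nonneg: "0 \<le> ovl p q T"
  by (simp add: ovl_def)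

lemma ovl_eq_0: "hpar p \<inter> hpar q \<inter> T \<times> UNIV = {} \<Longrightarrow> ovl p q T = 0"
  by (simp add: ovl_def)

lemma ovl_mono:
  assumes "S \<subseteq> T" "T \<in> sets borel" "S \<in> sets borel" "valid_vpar p"
  shows "ovl p q S \<le> ovl p q T"
proof -
  have T: "hpar p \<inter> hpar q \<inter> T \<times> UNIV \<in> sets lebesgue" and S: "hpar p \<inter> hpar q \<inter> S \<times> UNIV \<in> sets lebesgue"
    using hpar_borel Times_UNIV_borel assms by auto
  show ?thesis unfolding ovl_def
    by (rule measure_mono_fmeasurable[OF _ S fmeasurableI2[OF hpar_lmeasurable[OF assms(4)] _ T]])
      (use assms(1) in auto)
qed

lemma dint_borel [simp]: "dint c k m \<in> sets borel" "emeasure lborel (dint c k m) < top"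
  "measure lborel (dint c k m) = 2 powr k"
  unfolding dint_eq by simp_all

section \<open>Grid structure and sparseness of the selected family\<close>

locale sparse_family =
  fixes c :: "int \<Rightarrow> real" and gs :: "vpar list" and n :: nat
  assumes grid: "dyadic_grid c"
    and valid: "i < n \<Longrightarrow> valid_vpar (gs ! i)"
    and in_grid: "i < n \<Longrightarrow> shadow_in_grid c (gs ! i)"
    and widths: "i \<le> j \<Longrightarrow> j < n \<Longrightarrow> wid (gs ! j) \<le> wid (gs ! i)"
    and sparse: "i < n \<Longrightarrow> \<exists>x y. (x, y) \<in> hpar (gs ! i) \<and> sparse_at gs i x y"
begin

abbreviation "R i \<equiv> gs ! i"
abbreviation "h i \<equiv> pheight (gs ! i)"
abbreviation "w i \<equiv> wid (gs ! i)"
abbreviation "I i \<equiv> base (gs ! i)"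
abbreviation "s i \<equiv> pslope (gs ! i)"

lemma w_pos: "i < n \<Longrightarrow> 0 < w i" and h_pos: "i < n \<Longrightarrow> 0 < h i"
  using valid valid_vparD by blast+

lemma dint_nested:
  "dint c k m \<inter> dint c k' m' \<noteq> {} \<Longrightarrow> dint c k m \<subseteq> dint c k' m' \<or> dint c k' m' \<subseteq> dint c k m"
  using grid unfolding dyadic_grid_def by blast

lemma base_dint: "i < n \<Longrightarrow> \<exists>k m. I i = dint c k m"
  using base_in_grid[OF valid in_grid] .

lemma base_subset_dint_w:
  assumes "i < n" "I i \<subseteq> dint c k m"
  shows "w i \<le> 2 powr k"
proof -
  have "measure lborel (I i) \<le> measure lborel (dint c k m)"
    using assms(2) by (intro measure_mono_fmeasurable) (auto simp: dint_eq fmeasurable_def)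
  then show ?thesis by (simp add: measure_base valid assms dint_eq)
qed

lemma dint_subset_base_w:
  assumes "i < n" "dint c k m \<subseteq> I i"
  shows "2 powr k \<le> w i"
proof -
  have "measure lborel (dint c k m) \<le> measure lborel (I i)"
    using assms(2) by (intro measure_mono_fmeasurable) (auto simp: dint_eq fmeasurable_def)
  then show ?thesis by (simp add: measure_base valid assms dint_eq)
qed

lemma base_dint_eq:
  assumes "i < n" "dint c k m \<subseteq> I i" "w i \<le> 2 powr k"
  shows "I i = dint c k m"
proof -
  have "pa (R i) < pb (R i)" using valid_vparD[OF valid[OF assms(1)]] by simp
  then show ?thesis using assms(2,3) unfolding base_def dint_eq wid_def by (auto simp: ivl_subset)
qed

text \<open>Nestedness can go the wrong way only when the lengths agree, and then the two bases
  coincide.\<close>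

lemma base_nested:
  assumes "i < n" "j < n" "w j \<le> w i" "I i \<inter> I j \<noteq> {}"
  shows "I j \<subseteq> I i"
proof -
  obtain k m k' m' where e: "I i = dint c k m" "I j = dint c k' m'" using base_dint assms by metis
  then consider "I i \<subseteq> I j" | "I j \<subseteq> I i" using dint_nested[of k m k' m'] assms(4) by auto
  then show ?thesis
  proof cases
    case 1
    then have "w j \<le> 2 powr k" using dint_subset_base_w[OF assms(2), of k m]
        base_subset_dint_w[OF assms(1), of k m] e assms by auto
    then show ?thesis using base_dint_eq[OF assms(2), of k m] 1 e by auto
  qed
qed

lemma meet_base_nested:
  assumes "i \<le> j" "j < n" "hpar (R i) \<inter> hpar (R j) \<noteq> {}"
  shows "I j \<subseteq> I i"
  using assms base_nested[of i j] widths[of i j] by (force simp: mem_hpar)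

lemma base_dist: "x \<in> I i \<Longrightarrow> z \<in> I i \<Longrightarrow> \<bar>x - z\<bar> \<le> w i"
  by (auto simp: base_def wid_def)

text \<open>Sparseness at radius \<open>2 * \<rho>\<close> bounds the sum of the heights truncated
  at \<open>\<rho>\<close> by \<open>\<rho> / 5\<close>. A sum this small has no term that was
  actually truncated, so it is the sum of the heights themselves.\<close>

lemma sparse_core:
  assumes "i < n" "sparse_at gs i x y" "M \<subseteq> {..<i}" "0 < \<rho>"
    and near: "\<And>j. j \<in> M \<Longrightarrow> \<exists>z\<in>slice (R j) x. \<bar>z - y\<bar> \<le> \<rho>"
  shows "(\<Sum>j\<in>M. h j) < \<rho> / 5"
proof -
  have fin: "finite M" using assms(3) finite_subset by blast
  have "(\<Sum>j\<in>M. min (h j) \<rho>) \<le> (\<Sum>j\<in>M. load (R j) x y (2 * \<rho>))"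
  proof (rule sum_mono)
    fix j assume j: "j \<in> M"
    obtain z where z: "z \<in> slice (R j) x" "\<bar>z - y\<bar> \<le> \<rho>" using near[OF j] by auto
    have "j < n" using j assms by auto
    moreover have "x \<in> I j" using z by (auto simp: slice_eq split: if_splits)
    ultimately show "min (h j) \<rho> \<le> load (R j) x y (2 * \<rho>)" using load_ge[OF valid _ z] by blast
  qed
  also have "\<dots> \<le> (\<Sum>j<i. load (R j) x y (2 * \<rho>))"
    using assms(3) by (intro sum_mono2) (auto simp: load_nonneg)
  also have "\<dots> < 2 * \<rho> / 10" using assms(2,4) unfolding sparse_at_def by (metis mult_pos_pos zero_less_numeral)
  finally have lt: "(\<Sum>j\<in>M. min (h j) \<rho>) < \<rho> / 5" by simp
  have pos: "0 \<le> min (h j) \<rho>" if "j \<in> M" for j using that assms h_pos[of j] by force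
  have "h j < \<rho>" if "j \<in> M" for j
    using member_le_sum[of j M "\<lambda>j. min (h j) \<rho>"] that pos fin lt assms(4) by fastforce
  then have "(\<Sum>j\<in>M. min (h j) \<rho>) = (\<Sum>j\<in>M. h j)" by (intro sum.cong) (auto simp: min_def intro: less_imp_le)
  then show ?thesis using lt by simp
qed

text \<open>The quotient \<open>h i / w i\<close> is half the length of \<open>Uset (R i)\<close>, so this says that the two slope
  intervals meet after doubling.\<close>

definition close :: "nat \<Rightarrow> nat \<Rightarrow> bool" where
  "close i j \<longleftrightarrow> \<bar>s i - s j\<bar> < 2 * (h i / w i + h j / w j)"

text \<open>Each earlier close \<open>R j\<close> that meets \<open>R i\<close> passes within
  \<open>3 * h i + 2 * h j\<close> of the sparse point of \<open>R i\<close>, because the slopes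
  differ little and \<open>R j\<close> is at least as wide. Sparseness then bounds the sum of these
  \<open>h j\<close> by \<open>h i\<close>, and each overlap is at most
  \<open>w i * h j\<close>.\<close>

lemma close_overlap:
  assumes i: "i < n"
  shows "(\<Sum>j | j < i \<and> close j i. measure lebesgue (hpar (R j) \<inter> hpar (R i))) \<le> measure lebesgue (hpar (R i))"
proof -
  define M where "M = {j. j < i \<and> close j i \<and> hpar (R j) \<inter> hpar (R i) \<noteq> {}}"
  obtain x y where xy: "(x, y) \<in> hpar (R i)" "sparse_at gs i x y" using sparse[OF i] by auto
  have dist: "\<exists>z\<in>slice (R j) x. \<bar>z - y\<bar> \<le> \<rho>" if j: "j \<in> M" and \<rho>: "3 * h i + 2 * h j \<le> \<rho>" for j \<rho>
  proof -
    have jn: "j < n" using j i by (auto simp: M_def)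
    have sub: "I i \<subseteq> I j" using j i by (intro meet_base_nested) (auto simp: M_def)
    have wij: "w i \<le> w j" using j i widths[of j i] by (auto simp: M_def)
    obtain x1 y1 where p: "(x1, y1) \<in> hpar (R j)" "(x1, y1) \<in> hpar (R i)" using j by (auto simp: M_def)
    have "\<bar>s j - s i\<bar> \<le> 2 * (h j / w j + h i / w i)" using j by (auto simp: M_def close_def)
    from bot_drift[OF base_dist this, of x i x1] p xy
    have "\<bar>(bot (R j) x - bot (R i) x) - (bot (R j) x1 - bot (R i) x1)\<bar>
      \<le> 2 * (h j / w j + h i / w i) * w i" by (auto simp: mem_hpar)
    also have "\<dots> = 2 * (h j * (w i / w j) + h i)" using w_pos[OF i] by (simp add: field_simps)
    also have "\<dots> \<le> 2 * (h j * 1 + h i)"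
      using wij h_pos[OF jn] w_pos[OF jn] by (intro mult_left_mono add_mono) auto
    finally have "\<bar>(bot (R j) x - bot (R i) x) - (bot (R j) x1 - bot (R i) x1)\<bar> \<le> 2 * (h j + h i)" by simp
    then show ?thesis
      using hpar_meet[OF p] xy(1) sub h_pos[OF i] h_pos[OF jn] \<rho>
      by (intro slice_near) (auto simp: mem_hpar abs_le_iff)
  qed
  \<comment> \<open>Sparseness applied to \<open>j\<close> alone gives
    \<open>5 * h j < 3 * h i + 2 * h j\<close>. Afterwards the tolerance \<open>5 * h i\<close>
    serves for all of \<open>M\<close> at once.\<close>
  have hj: "h j < h i" if j: "j \<in> M" for j
    using sparse_core[OF i xy(2), of "{j}" "3 * h i + 2 * h j"] dist[OF j] j i h_pos[OF i] h_pos[of j]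
    by (auto simp: M_def)
  have Mi: "M \<subseteq> {..<i}" by (auto simp: M_def)
  have "(\<Sum>j\<in>M. h j) < 5 * h i / 5"
    using hj h_pos[OF i] by (intro sparse_core[OF i xy(2) Mi] dist) (auto dest: less_imp_le)
  then have Mh: "(\<Sum>j\<in>M. h j) \<le> h i" by simp
  have "(\<Sum>j | j < i \<and> close j i. measure lebesgue (hpar (R j) \<inter> hpar (R i)))
      = (\<Sum>j\<in>M. measure lebesgue (hpar (R j) \<inter> hpar (R i)))"
    by (intro sum.mono_neutral_right) (auto simp: M_def)
  also have "\<dots> \<le> (\<Sum>j\<in>M. w i * h j)"
  proof (rule sum_mono)
    fix j assume "j \<in> M"
    then have jn: "j < n" using i by (auto simp: M_def)
    have "hpar (R j) \<inter> hpar (R i) = hpar (R i) \<inter> hpar (R j) \<inter> I i \<times> UNIV" by (auto simp: mem_hpar)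
    then have "measure lebesgue (hpar (R j) \<inter> hpar (R i)) = ovl (R i) (R j) (I i)" by (simp add: ovl_def)
    also have "\<dots> \<le> w i * h j"
      using ovl_le_strip[OF valid[OF jn], of "I i" "R i"] by (simp add: measure_base valid i)
    finally show "measure lebesgue (hpar (R j) \<inter> hpar (R i)) \<le> w i * h j" .
  qed
  also have "\<dots> \<le> w i * h i"
    using Mh w_pos[OF i] by (simp add: sum_distrib_left[symmetric])
  finally show ?thesis by (simp add: measure_hpar valid i)
qed

section \<open>Far pairs grouped by slope difference\<close>

definition cls :: "nat \<Rightarrow> real \<Rightarrow> nat set" where
  "cls p v = {i. p < i \<and> i < n \<and> hpar (R p) \<inter> hpar (R i) \<noteq> {} \<and> \<not> close p i \<and>
     v \<le> \<bar>s p - s i\<bar> \<and> \<bar>s p - s i\<bar> < 2 * v}"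

text \<open>As the pair is not close, \<open>h i / w i\<close> is at most half the slope difference,
  which is below \<open>2 * v\<close>.\<close>

lemma cls_h:
  assumes "i \<in> cls p v"
  shows "h i \<le> v * w i"
proof -
  have i: "i < n" "p < n" using assms by (auto simp: cls_def)
  have "2 * (h i / w i) \<le> 2 * (h p / w p + h i / w i)"
    using w_pos[OF i(2)] h_pos[OF i(2)] by (auto intro: divide_nonneg_nonneg less_imp_le)
  also have "\<dots> \<le> 2 * v" using assms by (auto simp: cls_def close_def)
  finally show ?thesis using w_pos[OF i(1)] by (simp add: field_simps)
qed

lemma cls_single:
  assumes v: "0 < v" and i: "i \<in> cls p v" and T: "T \<in> sets borel" "emeasure lborel T < top"
  shows "ovl (R p) (R i) T \<le> 2 * h p * h i / v"
  using assms by (intro ovl_le_transversal valid) (auto simp: cls_def)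

text \<open>\<open>R i\<close> and the contributing members of \<open>M\<close> all meet
  \<open>R p\<close> above an interval of length \<open>L\<close>, with slopes within
  \<open>2 * v\<close> of that of \<open>R p\<close>. So they pass within a multiple of
  \<open>v * L\<close> of the sparse point of \<open>R i\<close>, and sparseness bounds their total
  height. The transversal bound \<open>2 * h p * h j / v\<close> turns this into a multiple of
  \<open>h p * L\<close>.\<close>

lemma cls_prior_overlap:
  assumes v: "0 < v" and i: "i \<in> cls p v" and iT: "I i \<subseteq> dint c k m"
    and M: "\<And>j. j \<in> M \<Longrightarrow> j \<in> cls p v \<and> j < i \<and> dint c k m \<subseteq> I j"
  shows "(\<Sum>j\<in>M. ovl (R p) (R j) (dint c k m)) \<le> 12 / 5 * h p * 2 powr k"
proof -
  define T where "T = dint c k m"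
  define L where "L = (2::real) powr k"
  have L: "L > 0" by (simp add: L_def)
  have T: "T \<in> sets borel" "emeasure lborel T < top" "measure lborel T = L"
    unfolding T_def L_def dint_eq by simp_all
  have Td: "\<bar>x - z\<bar> \<le> L" if "x \<in> T" "z \<in> T" for x z
    using that by (auto simp: T_def L_def dint_eq)
  have n: "i < n" "p < i" "p < n" using i by (auto simp: cls_def)
  have finM: "finite M" by (rule finite_subset[of _ "{..<i}"]) (use M in auto)
  \<comment> \<open>Members with no overlap above \<open>T\<close> contribute nothing, and nothing
    is known about their position near the sparse point.\<close>
  define M' where "M' = {j\<in>M. hpar (R p) \<inter> hpar (R j) \<inter> T \<times> UNIV \<noteq> {}}"
  have sum_eq: "(\<Sum>j\<in>M. ovl (R p) (R j) T) = (\<Sum>j\<in>M'. ovl (R p) (R j) T)"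
    using finM by (intro sum.mono_neutral_right) (auto simp: M'_def ovl_eq_0)
  have "(\<Sum>j\<in>M'. ovl (R p) (R j) T) \<le> 12 / 5 * h p * L"
  proof (cases "M' = {}")
    case True
    then show ?thesis using L h_pos[OF n(3)] by simp
  next
    case False
    \<comment> \<open>Any member of \<open>M'\<close> shows that \<open>T\<close> lies in the base
      of \<open>R p\<close>.\<close>
    then obtain j0 where "j0 \<in> M" by (auto simp: M'_def)
    with M[of j0] have j0: "p < j0" "j0 < n" "hpar (R p) \<inter> hpar (R j0) \<noteq> {}" "T \<subseteq> I j0"
      by (auto simp: cls_def T_def)
    then have Tp: "T \<subseteq> I p" using meet_base_nested[of p j0] by auto
    obtain x y where xy: "(x, y) \<in> hpar (R i)" "sparse_at gs i x y" using sparse[OF n(1)] by auto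
    have xT: "x \<in> T" using xy(1) iT by (auto simp: mem_hpar T_def)
    have hi: "h i \<le> v * L"
      using cls_h[OF i] base_subset_dint_w[OF n(1) iT] v unfolding L_def
      by (meson mult_left_mono order_trans less_imp_le)
    obtain x2 y2 where p2: "(x2, y2) \<in> hpar (R p)" "(x2, y2) \<in> hpar (R i)" using i by (auto simp: cls_def)
    have x2: "x2 \<in> T" using p2 iT by (auto simp: mem_hpar T_def)
    have "\<bar>s p - s i\<bar> \<le> 2 * v" using i by (auto simp: cls_def)
    from bot_drift[OF Td[OF xT x2] this]
    have d1: "\<bar>(bot (R p) x - bot (R i) x) - (bot (R p) x2 - bot (R i) x2)\<bar> \<le> 2 * (v * L)" by simp
    have vL: "0 < v * L" using v L by simp
    \<comment> \<open>\<open>p\<close> is itself selected before \<open>i\<close>. A drift of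
      \<open>2 * (v * L)\<close> plus \<open>h i\<close>, at most \<open>v * L\<close>, gives the
      tolerance \<open>3 * (v * L)\<close>.\<close>
    have hp: "h p < 3 * (v * L) / 5"
    proof -
      have "\<exists>z\<in>slice (R p) x. \<bar>z - y\<bar> \<le> 3 * (v * L)"
        using hpar_meet[OF p2] xy(1) xT Tp d1 hi h_pos[OF n(3)] vL
        by (intro slice_near) (auto simp: mem_hpar abs_le_iff)
      then show ?thesis using sparse_core[OF n(1) xy(2), of "{p}" "3 * (v * L)"] n vL by auto
    qed
    \<comment> \<open>Two drifts of \<open>2 * (v * L)\<close>, between \<open>R j\<close> and
      \<open>R p\<close> and between \<open>R p\<close> and \<open>R i\<close>, together with
      \<open>h i\<close> and \<open>h p\<close> stay below \<open>6 * (v * L)\<close>.\<close>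
    have near: "\<exists>z\<in>slice (R j) x. \<bar>z - y\<bar> \<le> 6 * (v * L)" if "j \<in> M'" for j
    proof -
      have j: "j \<in> cls p v" "j < i" "T \<subseteq> I j" using M[of j] that by (auto simp: M'_def T_def)
      obtain x3 y3 where p3: "(x3, y3) \<in> hpar (R j)" "(x3, y3) \<in> hpar (R p)" "x3 \<in> T"
        using \<open>j \<in> M'\<close> by (auto simp: M'_def)
      have "\<bar>s j - s p\<bar> \<le> 2 * v" using j by (auto simp: cls_def)
      from bot_drift[OF Td[OF xT p3(3)] this]
      have d2: "\<bar>(bot (R j) x - bot (R p) x) - (bot (R j) x3 - bot (R p) x3)\<bar> \<le> 2 * (v * L)" by simp
      show ?thesis
        using hpar_meet[OF p2] hpar_meet[OF p3(1,2)] xy(1) xT j(2,3) d1 d2 hi hp h_pos[of j] n vL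
        by (intro slice_near) (auto simp: mem_hpar abs_le_iff)
    qed
    have M'h: "(\<Sum>j\<in>M'. h j) < 6 * (v * L) / 5"
      by (rule sparse_core[OF n(1) xy(2) _ _ near]) (use M vL in \<open>auto simp: M'_def\<close>)
    have "(\<Sum>j\<in>M'. ovl (R p) (R j) T) \<le> (\<Sum>j\<in>M'. 2 * h p / v * h j)"
    proof (rule sum_mono)
      fix j assume "j \<in> M'"
      then have "j \<in> cls p v" using M by (auto simp: M'_def)
      from cls_single[OF v this T(1,2)]
      show "ovl (R p) (R j) T \<le> 2 * h p / v * h j" by simp
    qed
    also have "\<dots> = 2 * h p / v * (\<Sum>j\<in>M'. h j)" by (simp add: sum_distrib_left)
    also have "\<dots> \<le> 2 * h p / v * (6 * (v * L) / 5)"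
      using M'h h_pos[OF n(3)] v by (intro mult_left_mono) auto
    also have "\<dots> = 12 / 5 * h p * L" using v by simp
    finally show ?thesis .
  qed
  then show ?thesis using sum_eq unfolding T_def L_def by simp
qed

lemma finite_cls: "finite (cls p v)"
  by (rule finite_subset[of _ "{..<n}"]) (auto simp: cls_def)

lemma base_nonempty: "i < n \<Longrightarrow> I i \<noteq> {}"
  using w_pos[of i] by (auto simp: base_def wid_def)

text \<open>A base inside the parent but inside neither half meets both halves, so by nestedness it
  contains both. Otherwise nestedness with the parent itself decides.\<close>

lemma straddle:
  assumes i: "i < n" and T: "dint c k m = dint c l a \<union> dint c l b"
    and meet: "I i \<inter> dint c k m \<noteq> {}"
    and nsub: "\<not> I i \<subseteq> dint c l a" "\<not> I i \<subseteq> dint c l b"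
  shows "dint c k m \<subseteq> I i"
proof -
  obtain k' m' where e: "I i = dint c k' m'" using base_dint[OF i] by auto
  show ?thesis
  proof (cases "I i \<subseteq> dint c k m")
    case True
    have "I i \<inter> dint c l a \<noteq> {}" "I i \<inter> dint c l b \<noteq> {}" using True nsub T by auto
    then have "dint c l a \<subseteq> I i" "dint c l b \<subseteq> I i" using dint_nested nsub unfolding e by blast+
    then show ?thesis using T by simp
  next
    case False
    then show ?thesis using dint_nested[of k' m' k m] meet e by auto
  qed
qed

text \<open>A member whose base meets the half \<open>a\<close> must straddle the whole interval, hence it was
  selected before \<open>i\<close>, and the sparseness of \<open>i\<close> controls all such members at once.\<close>

lemma cls_half:
  assumes v: "0 < v" and T: "dint c k m = dint c l a \<union> dint c l b" "dint c l a \<inter> dint c l b = {}"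
    and l: "l < k" and a: "\<not> (\<exists>j\<in>cls p v. I j \<subseteq> dint c l a)" and b: "i \<in> cls p v" "I i \<subseteq> dint c l b"
  shows "(\<Sum>j\<in>cls p v. ovl (R p) (R j) (dint c l a)) \<le> 12 / 5 * h p * 2 powr k"
proof -
  have n: "i < n" "p < n" using b by (auto simp: cls_def)
  define M where "M = {j \<in> cls p v. I j \<inter> dint c l a \<noteq> {}}"
  have M: "j \<in> cls p v \<and> j < i \<and> dint c k m \<subseteq> I j" if "j \<in> M" for j
  proof -
    have j: "j \<in> cls p v" "j < n" "I j \<inter> dint c l a \<noteq> {}" using that by (auto simp: M_def cls_def)
    have sub: "dint c k m \<subseteq> I j" using j a T by (intro straddle[OF j(2) T(1)]) auto
    \<comment> \<open>The list is only weakly decreasing in width; the strict drop of scale from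
      \<open>k\<close> to \<open>l\<close> is what places \<open>j\<close> before
      \<open>i\<close>.\<close>
    have "(2::real) powr l < 2 powr k" using l by simp
    then have "w i < w j" using dint_subset_base_w[OF j(2) sub] base_subset_dint_w[OF n(1) b(2)] by linarith
    then have "j < i" using widths[of i j] j by (meson not_le)
    then show ?thesis using j sub by simp
  qed
  have "(\<Sum>j\<in>cls p v. ovl (R p) (R j) (dint c l a)) = (\<Sum>j\<in>M. ovl (R p) (R j) (dint c l a))"
    by (intro sum.mono_neutral_right) (auto simp: M_def finite_cls mem_hpar intro!: ovl_eq_0)
  also have "\<dots> \<le> (\<Sum>j\<in>M. ovl (R p) (R j) (dint c k m))"
    using T n by (intro sum_mono ovl_mono valid) auto
  also have "\<dots> \<le> 12 / 5 * h p * 2 powr k"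
    using T b by (intro cls_prior_overlap[OF v b(1) _ M]) auto
  finally show ?thesis .
qed

text \<open>Carleson type bound, by descent through dyadic halves. A half containing a base of the
  group is handled by induction, a half whose sibling alone contains one by \<open>cls_half\<close>,
  where \<open>12 / 5 * 2 powr k\<close> is \<open>24 / 5 * 2 powr (k - 1)\<close>. If neither half
  contains one, the last member meeting the interval has it as its base, and the bounds
  \<open>2\<close> for this member and \<open>12 / 5\<close> for the earlier ones add up to less
  than \<open>5\<close>.\<close>

lemma cls_dint:
  assumes v: "0 < v" and i: "i \<in> cls p v" "I i \<subseteq> dint c k m"
  shows "(\<Sum>j\<in>cls p v. ovl (R p) (R j) (dint c k m)) \<le> 5 * h p * 2 powr k"
proof -
  have n: "i < n" "p < n" using i by (auto simp: cls_def)
  \<comment> \<open>The last member has the least width, and an interval shorter than this contains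
    no base; this starts the induction.\<close>
  define \<epsilon> where "\<epsilon> = w (n - 1)"
  have \<epsilon>: "\<epsilon> > 0" "\<And>j. j < n \<Longrightarrow> \<epsilon> \<le> w j" unfolding \<epsilon>_def using w_pos[of "n - 1"] n by (auto intro: widths)
  have "(\<Sum>j\<in>cls p v. ovl (R p) (R j) (dint c k m)) \<le> 5 * h p * 2 powr k"
    if "2 powr k < 2 ^ N * \<epsilon>" "i \<in> cls p v" "I i \<subseteq> dint c k m" for N k m i
    using that
  proof (induction N arbitrary: k m i)
    case 0
    then show ?case using \<epsilon>(2)[of i] base_subset_dint_w[of i k m] by (auto simp: cls_def)
  next
    case (Suc N)
    have inn: "i < n" using Suc.prems by (auto simp: cls_def)
    obtain a b where T: "dint c k m = dint c (k - 1) a \<union> dint c (k - 1) b"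
      "dint c (k - 1) a \<inter> dint c (k - 1) b = {}"
      using dyadic_halves[OF grid, of k m] by metis
    have half: "(2::real) powr k = 2 * 2 powr (k - 1)" by (simp add: powr_diff)
    then have lt: "2 powr (k - 1) < 2 ^ N * \<epsilon>" using Suc.prems(1) by simp
    define P where "P d \<longleftrightarrow> (\<exists>j\<in>cls p v. I j \<subseteq> dint c (k - 1) d)" for d
    have IH: "(\<Sum>j\<in>cls p v. ovl (R p) (R j) (dint c (k - 1) d)) \<le> 5 * h p * 2 powr (k - 1)" if "P d" for d
      using that Suc.IH[OF lt] unfolding P_def by blast
    have hp: "0 \<le> h p * 2 powr (k - 1)" using h_pos[OF n(2)] by simp
    show ?case
    proof (cases "P a \<or> P b")
      case True
      have "(\<Sum>j\<in>cls p v. ovl (R p) (R j) (dint c (k - 1) d)) \<le> 5 * h p * 2 powr (k - 1)"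
        if d: "d = a \<or> d = b" for d
      proof (cases "P d")
        case False
        then obtain d' j where d': "dint c k m = dint c (k - 1) d \<union> dint c (k - 1) d'"
          "dint c (k - 1) d \<inter> dint c (k - 1) d' = {}" "j \<in> cls p v" "I j \<subseteq> dint c (k - 1) d'"
          using True T d unfolding P_def by (metis Int_commute Un_commute)
        have "(\<Sum>j\<in>cls p v. ovl (R p) (R j) (dint c (k - 1) d)) \<le> 12 / 5 * h p * 2 powr k"
          using False unfolding P_def by (intro cls_half[OF v d'(1,2) _ _ d'(3,4)]) auto
        then show ?thesis unfolding half using hp by simp
      qed (rule IH)
      from add_mono[OF this[of a] this[of b]]
      have "(\<Sum>j\<in>cls p v. ovl (R p) (R j) (dint c (k - 1) a) + ovl (R p) (R j) (dint c (k - 1) b))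
        \<le> 5 * h p * 2 powr k" unfolding half by (simp add: sum.distrib)
      moreover have "(\<Sum>j\<in>cls p v. ovl (R p) (R j) (dint c k m)) \<le>
          (\<Sum>j\<in>cls p v. ovl (R p) (R j) (dint c (k - 1) a) + ovl (R p) (R j) (dint c (k - 1) b))"
        unfolding T(1) by (intro sum_mono ovl_Un_le) auto
      ultimately show ?thesis by linarith
    next
      case False
      define M where "M = {j \<in> cls p v. dint c k m \<subseteq> I j}"
      have fM: "finite M" using finite_cls by (simp add: M_def)
      have Mall: "j \<in> M" if "j \<in> cls p v" "I j \<inter> dint c k m \<noteq> {}" for j
        using straddle[OF _ T(1), of j] that False by (auto simp: M_def P_def cls_def)
      have iM: "i \<in> M" using Mall[OF Suc.prems(2)] Suc.prems(3) base_nonempty[OF inn] by blast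
      \<comment> \<open>The last member of \<open>M\<close> comes no earlier than \<open>i\<close>,
        so it is no wider than the interval that its base contains. Hence its base equals the
        interval, and the rest of \<open>M\<close> precedes it.\<close>
      define q where "q = Max M"
      have q: "q \<in> M" "i \<le> q" "\<And>j. j \<in> M \<Longrightarrow> j \<le> q" using fM iM by (auto simp: q_def intro: Max_in)
      have qc: "q \<in> cls p v" "q < n" "dint c k m \<subseteq> I q" using q(1) by (auto simp: M_def cls_def)
      have wq: "w q \<le> 2 powr k"
        using widths[OF q(2) qc(2)] base_subset_dint_w[OF inn Suc.prems(3)] by linarith
      have Iq: "I q = dint c k m" by (rule base_dint_eq[OF qc(2,3) wq])
      have "(\<Sum>j\<in>cls p v. ovl (R p) (R j) (dint c k m)) = (\<Sum>j\<in>M. ovl (R p) (R j) (dint c k m))"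
        using Mall
        by (intro sum.mono_neutral_right) (auto simp: finite_cls mem_hpar M_def intro!: ovl_eq_0, blast)
      also have "\<dots> = ovl (R p) (R q) (dint c k m) + (\<Sum>j\<in>M - {q}. ovl (R p) (R j) (dint c k m))"
        using fM q(1) by (simp add: sum.remove)
      also have "\<dots> \<le> 2 * h p * h q / v + 12 / 5 * h p * 2 powr k"
      proof (intro add_mono cls_single[OF v qc(1)] cls_prior_overlap[OF v qc(1)])
        fix j assume "j \<in> M - {q}"
        then show "j \<in> cls p v \<and> j < q \<and> dint c k m \<subseteq> I j"
          using q(3)[of j] by (auto simp: M_def)
      qed (auto simp: Iq)
      also have "2 * h p * h q / v \<le> 2 * h p * 2 powr k"
      proof -
        have "h q \<le> v * 2 powr k" using cls_h[OF qc(1)] wq v by (meson mult_left_mono order_trans less_imp_le)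
        then have "h q / v \<le> 2 powr k" using v by (simp add: field_simps)
        then show ?thesis using h_pos[OF n(2)] mult_left_mono[of "h q / v" "2 powr k" "2 * h p"] by simp
      qed
      also have "2 * h p * 2 powr k + 12 / 5 * h p * 2 powr k \<le> 5 * h p * 2 powr k"
        using hp unfolding half by simp
      finally show ?thesis by simp
    qed
  qed
  moreover obtain N where "2 powr k / \<epsilon> < 2 ^ N" using real_arch_pow[of 2 "2 powr k / \<epsilon>"] by auto
  ultimately show ?thesis using i \<epsilon>(1) by (auto simp: field_simps)
qed

end

section \<open>Using the direction field\<close>

locale directed_family = sparse_family +
  fixes u :: "real \<Rightarrow> real" and \<delta> :: real
  assumes u: "u \<in> borel_measurable lebesgue" and \<delta>: "0 < \<delta>" "\<delta> \<le> 1"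
    and dense: "i < n \<Longrightarrow>
      \<delta> * wid (gs ! i) \<le> measure lebesgue {x \<in> base (gs ! i). \<bar>u x - pslope (gs ! i)\<bar> \<le> pheight (gs ! i) / wid (gs ! i)}"
begin

text \<open>An annulus of directions about \<open>s p\<close>. The factors \<open>1 / 2\<close> and
  \<open>3\<close> leave room for the deviation of \<open>u\<close> from a slope at distance between
  \<open>v\<close> and \<open>2 * v\<close>.\<close>

definition ann :: "nat \<Rightarrow> real \<Rightarrow> real set \<Rightarrow> real set" where
  "ann p v T = {x \<in> T. v / 2 \<le> \<bar>u x - s p\<bar> \<and> \<bar>u x - s p\<bar> < 3 * v}"

lemma ann_sets: "T \<in> sets borel \<Longrightarrow> ann p v T \<in> sets lebesgue"
proof -
  assume T: "T \<in> sets borel"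
  have [measurable]: "u \<in> borel_measurable lebesgue" by (rule u)
  have "{x \<in> space lebesgue. v / 2 \<le> \<bar>u x - s p\<bar> \<and> \<bar>u x - s p\<bar> < 3 * v} \<in> sets lebesgue" by measurable
  moreover have "T \<in> sets lebesgue" using T by simp
  ultimately have "T \<inter> {x \<in> space lebesgue. v / 2 \<le> \<bar>u x - s p\<bar> \<and> \<bar>u x - s p\<bar> < 3 * v} \<in> sets lebesgue"
    by (rule sets.Int[rotated])
  then show ?thesis by (simp add: ann_def Int_def)
qed

lemma ann_lmeasurable: "T \<in> sets borel \<Longrightarrow> emeasure lborel T < top \<Longrightarrow> ann p v T \<in> lmeasurable"
proof -
  assume T: "T \<in> sets borel" "emeasure lborel T < top"
  have "ann p v T \<subseteq> T" by (auto simp: ann_def)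
  then show ?thesis using T by (intro fmeasurableI2[OF _ _ ann_sets[OF T(1)], of T]) (auto simp: fmeasurable_def)
qed

text \<open>As the pair is not close, \<open>h i / w i\<close> is at most half of
  \<open>|s p - s i|\<close>. Where \<open>u\<close> is that near to \<open>s i\<close>, its
  distance from \<open>s p\<close> is between one half and three halves of
  \<open>|s p - s i|\<close>.\<close>

lemma cls_wid_le:
  assumes "0 < v" "i \<in> cls p v"
  shows "\<delta> * w i \<le> measure lebesgue (ann p v (I i))"
proof -
  have i: "i < n" "p < n" using assms by (auto simp: cls_def)
  have "\<delta> * w i \<le> measure lebesgue {x \<in> I i. \<bar>u x - s i\<bar> \<le> h i / w i}" by (rule dense[OF i(1)])
  also have "\<dots> \<le> measure lebesgue (ann p v (I i))"
  proof (rule measure_mono_fmeasurable)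
    have [measurable]: "u \<in> borel_measurable lebesgue" by (rule u)
    have "{x \<in> space lebesgue. \<bar>u x - s i\<bar> \<le> h i / w i} \<in> sets lebesgue" by measurable
    moreover have "I i \<in> sets lebesgue" by simp
    ultimately have "I i \<inter> {x \<in> space lebesgue. \<bar>u x - s i\<bar> \<le> h i / w i} \<in> sets lebesgue"
      by (rule sets.Int[rotated])
    then show "{x \<in> I i. \<bar>u x - s i\<bar> \<le> h i / w i} \<in> sets lebesgue" by (simp add: Int_def)
    define q where "q = h i / w i"
    have "0 < h p / w p" using w_pos h_pos i by simp
    then have "2 * q \<le> \<bar>s p - s i\<bar>" "v \<le> \<bar>s p - s i\<bar>" "\<bar>s p - s i\<bar> < 2 * v"
      using assms unfolding cls_def close_def q_def by auto
    then have "v / 2 \<le> \<bar>u x - s p\<bar> \<and> \<bar>u x - s p\<bar> < 3 * v" if "\<bar>u x - s i\<bar> \<le> q" for x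
      using that by linarith
    then show "{x \<in> I i. \<bar>u x - s i\<bar> \<le> h i / w i} \<subseteq> ann p v (I i)"
      unfolding q_def ann_def by blast
  qed (auto intro: ann_lmeasurable)
  finally show ?thesis .
qed

text \<open>The maximal bases of the group are disjoint, lie in the base of \<open>R p\<close> and
  cover all bases of the group. Above each of them the Carleson bound is \<open>5 * h p\<close>
  times its length, and the length is at most \<open>1 / \<delta>\<close> times the measure of its
  part of the annulus.\<close>

lemma cls_overlap:
  assumes v: "0 < v" and p: "p < n"
  shows "(\<Sum>i\<in>cls p v. measure lebesgue (hpar (R p) \<inter> hpar (R i)))
    \<le> 5 * h p / \<delta> * measure lebesgue (ann p v (I p))"
proof -
  define A where "A = I ` cls p v"
  define Mx where "Mx = {T \<in> A. \<forall>T'\<in>A. T \<subseteq> T' \<longrightarrow> T = T'}"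
  have fA: "finite A" "finite Mx" using finite_cls by (auto simp: A_def Mx_def)
  have below: "\<exists>T\<in>Mx. I i \<subseteq> T" if "i \<in> cls p v" for i
    using finite_has_maximal2[OF fA(1), of "I i"] that by (auto simp: A_def Mx_def)
  have rep: "\<exists>i\<in>cls p v. T = I i" if "T \<in> Mx" for T using that by (auto simp: Mx_def A_def)
  have Tp: "T \<subseteq> I p \<and> T \<in> sets borel \<and> emeasure lborel T < top" if T: "T \<in> Mx" for T
  proof -
    obtain i where i: "i \<in> cls p v" "T = I i" using rep[OF T] by auto
    then show ?thesis using meet_base_nested[of p i] by (auto simp: cls_def)
  qed
  have disj: "T \<inter> T' = {}" if TT: "T \<in> Mx" "T' \<in> Mx" "T \<noteq> T'" for T T'
  proof (rule ccontr)
    assume ne: "T \<inter> T' \<noteq> {}"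
    obtain i j where ij: "i \<in> cls p v" "T = I i" "j \<in> cls p v" "T' = I j" 
      using rep[OF TT(1)] rep[OF TT(2)] by blast
    then have "i < n" "j < n" by (auto simp: cls_def)
    then obtain k m k' m' where "T = dint c k m" "T' = dint c k' m'" using base_dint ij by metis
    then have "T \<subseteq> T' \<or> T' \<subseteq> T" using dint_nested[of k m k' m'] ne by auto
    then show False using TT by (auto simp: Mx_def)
  qed
  have "(\<Sum>i\<in>cls p v. measure lebesgue (hpar (R p) \<inter> hpar (R i))) \<le> (\<Sum>i\<in>cls p v. \<Sum>T\<in>Mx. ovl (R p) (R i) T)"
  proof (rule sum_mono)
    fix i assume "i \<in> cls p v"
    then obtain T where T: "T \<in> Mx" "I i \<subseteq> T" using below by auto
    then have "hpar (R p) \<inter> hpar (R i) = hpar (R p) \<inter> hpar (R i) \<inter> T \<times> UNIV"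
      by (auto simp: mem_hpar)
    then have "measure lebesgue (hpar (R p) \<inter> hpar (R i)) = ovl (R p) (R i) T" by (simp add: ovl_def)
    also have "\<dots> \<le> (\<Sum>T\<in>Mx. ovl (R p) (R i) T)"
      using T fA by (intro member_le_sum) (auto simp: ovl_nonneg)
    finally show "measure lebesgue (hpar (R p) \<inter> hpar (R i)) \<le> (\<Sum>T\<in>Mx. ovl (R p) (R i) T)" .
  qed
  also have "\<dots> = (\<Sum>T\<in>Mx. \<Sum>i\<in>cls p v. ovl (R p) (R i) T)" by (rule sum.swap)
  also have "\<dots> \<le> (\<Sum>T\<in>Mx. 5 * h p / \<delta> * measure lebesgue (ann p v T))"
  proof (rule sum_mono)
    fix T assume "T \<in> Mx"
    then obtain i where i: "i \<in> cls p v" "T = I i" using rep by auto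
    then have n: "i < n" by (auto simp: cls_def)
    obtain k m where e: "I i = dint c k m" using base_dint[OF n] by auto
    have "w i = 2 powr k" using measure_base[OF valid[OF n]] unfolding e by simp
    then have "(\<Sum>i\<in>cls p v. ovl (R p) (R i) T) \<le> 5 * h p * w i"
      using cls_dint[OF v i(1), of k m] i e by simp
    also have "\<dots> \<le> 5 * h p * (measure lebesgue (ann p v T) / \<delta>)"
      using cls_wid_le[OF v i(1)] \<delta> h_pos[OF p] i(2) by (intro mult_left_mono) (auto simp: field_simps)
    finally show "(\<Sum>i\<in>cls p v. ovl (R p) (R i) T) \<le> 5 * h p / \<delta> * measure lebesgue (ann p v T)" by simp
  qed
  also have "\<dots> = 5 * h p / \<delta> * (\<Sum>T\<in>Mx. measure lebesgue (ann p v T))" by (simp add: sum_distrib_left)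
  also have "(\<Sum>T\<in>Mx. measure lebesgue (ann p v T)) = measure lebesgue (\<Union>T\<in>Mx. ann p v T)"
  proof (rule measure_UNION'[symmetric])
    show "pairwise (\<lambda>T T'. disjnt (ann p v T) (ann p v T')) Mx"
      using disj unfolding pairwise_def disjnt_def ann_def by blast
  qed (use Tp fA in \<open>auto intro: ann_lmeasurable\<close>)
  also have "5 * h p / \<delta> * \<dots> \<le> 5 * h p / \<delta> * measure lebesgue (ann p v (I p))"
  proof (intro mult_left_mono measure_mono_fmeasurable)
    show "(\<Union>T\<in>Mx. ann p v T) \<subseteq> ann p v (I p)" using Tp unfolding ann_def by blast
    show "(\<Union>T\<in>Mx. ann p v T) \<in> sets lebesgue" using Tp fA(2) by (auto intro: ann_sets)
    show "0 \<le> 5 * h p / \<delta>" using \<delta> h_pos[OF p] by simp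
  qed (simp add: ann_lmeasurable)
  finally show ?thesis .
qed

text \<open>At a given \<open>x\<close> the annulus condition puts \<open>2 powr k\<close> between
  \<open>|u x - s p| / 3\<close> and \<open>2 * |u x - s p|\<close>. With \<open>3\<close> rounded
  up to \<open>4\<close>, at most three integers \<open>k\<close> remain.\<close>

lemma sum_ann_le:
  assumes K: "finite K" and p: "p < n"
  shows "(\<Sum>k\<in>K. measure lebesgue (ann p (2 powr real_of_int k) (I p))) \<le> 3 * w p"
proof -
  let ?B = "\<lambda>k. ann p (2 powr real_of_int k) (I p)"
  have B: "?B k \<in> lmeasurable" for k by (rule ann_lmeasurable) auto
  have Ip: "I p \<in> lmeasurable" by (simp add: fmeasurable_def)
  have pt: "(\<Sum>k\<in>K. indicator (?B k) x) \<le> (3 * indicator (I p) x :: real)" for x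
  proof (cases "x \<in> I p")
    case True
    define m where "m = \<lfloor>log 2 \<bar>u x - s p\<bar>\<rfloor>"
    have sub: "{k\<in>K. x \<in> ?B k} \<subseteq> {m - 1..m + 1}"
    proof
      fix k assume "k \<in> {k\<in>K. x \<in> ?B k}"
      then have k: "2 powr k / 2 \<le> \<bar>u x - s p\<bar>" "\<bar>u x - s p\<bar> < 3 * 2 powr k" by (auto simp: ann_def)
      have pos: "0 < \<bar>u x - s p\<bar>" using k(1) by (smt (verit) powr_gt_zero half_gt_zero)
      have "2 powr (real_of_int k - 1) \<le> \<bar>u x - s p\<bar>" using k(1) by (simp add: powr_diff)
      then have "k - 1 \<le> log 2 \<bar>u x - s p\<bar>" using pos by (simp add: le_log_iff)
      moreover have "\<bar>u x - s p\<bar> < 2 powr (real_of_int k + 2)" using k(2) by (simp add: powr_add)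
      then have "log 2 \<bar>u x - s p\<bar> < k + 2" using pos by (simp add: log_less_iff)
      ultimately show "k \<in> {m - 1..m + 1}" unfolding m_def by (auto simp: le_floor_iff floor_le_iff) linarith+
    qed
    have "(\<Sum>k\<in>K. indicator (?B k) x) = real (card {k\<in>K. x \<in> ?B k})"
      using K by (simp add: indicator_def sum.If_cases Int_def)
    also have "card {k\<in>K. x \<in> ?B k} \<le> card {m - 1..m + 1}" by (rule card_mono[OF _ sub]) simp
    finally show ?thesis using True by simp
  next
    case False
    then show ?thesis by (auto simp: ann_def)
  qed
  have "(\<Sum>k\<in>K. measure lebesgue (?B k)) = (\<Sum>k\<in>K. \<integral>x. indicator (?B k) x \<partial>lebesgue)" by simp
  also have "\<dots> = (\<integral>x. (\<Sum>k\<in>K. indicator (?B k) x) \<partial>lebesgue)"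
    using B by (intro Bochner_Integration.integral_sum[symmetric]) (simp add: lmeasurable_iff_integrable)
  also have "\<dots> \<le> (\<integral>x. 3 * indicator (I p) x \<partial>lebesgue)"
    using B Ip pt by (intro integral_mono) (auto simp: lmeasurable_iff_integrable)
  also have "\<dots> = 3 * w p" using measure_base[OF valid[OF p]] by simp
  finally show ?thesis .
qed

text \<open>Dyadic decomposition of the slope difference, which is positive because the pair is not
  close. The constant \<open>15\<close> is \<open>5\<close> for each scale times the multiplicity
  \<open>3\<close> of the annuli.\<close>

lemma far_overlap:
  assumes p: "p < n"
  shows "(\<Sum>i | p < i \<and> i < n \<and> \<not> close p i. measure lebesgue (hpar (R p) \<inter> hpar (R i)))
    \<le> 15 / \<delta> * measure lebesgue (hpar (R p))"
proof -
  define F where "F = {i. p < i \<and> i < n \<and> \<not> close p i \<and> hpar (R p) \<inter> hpar (R i) \<noteq> {}}"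
  define \<kappa> where "\<kappa> i = \<lfloor>log 2 \<bar>s p - s i\<bar>\<rfloor>" for i
  have fF: "finite F" by (rule finite_subset[of _ "{..<n}"]) (auto simp: F_def)
  have "(\<Sum>i | p < i \<and> i < n \<and> \<not> close p i. measure lebesgue (hpar (R p) \<inter> hpar (R i)))
      = (\<Sum>i\<in>F. measure lebesgue (hpar (R p) \<inter> hpar (R i)))"
    by (intro sum.mono_neutral_right) (auto simp: F_def)
  also have "\<dots> = (\<Sum>k\<in>\<kappa> ` F. \<Sum>i\<in>{i\<in>F. \<kappa> i = k}. measure lebesgue (hpar (R p) \<inter> hpar (R i)))"
    by (rule sum.image_gen[OF fF])
  also have "\<dots> \<le> (\<Sum>k\<in>\<kappa> ` F. 5 * h p / \<delta> * measure lebesgue (ann p (2 powr real_of_int k) (I p)))"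
  proof (rule sum_mono)
    fix k
    have sub: "{i\<in>F. \<kappa> i = k} \<subseteq> cls p (2 powr real_of_int k)"
    proof
      fix i assume "i \<in> {i\<in>F. \<kappa> i = k}"
      then have i: "p < i" "i < n" "\<not> close p i" "hpar (R p) \<inter> hpar (R i) \<noteq> {}" "\<kappa> i = k" by (auto simp: F_def)
      have "0 < 2 * (h p / w p + h i / w i)"
        using w_pos[OF p] h_pos[OF p] w_pos[OF i(2)] h_pos[OF i(2)] by (simp add: add_pos_pos)
      then have pos: "0 < \<bar>s p - s i\<bar>" using i(3) by (auto simp: close_def)
      have "k \<le> log 2 \<bar>s p - s i\<bar>" "log 2 \<bar>s p - s i\<bar> < k + 1" using i(5) unfolding \<kappa>_def by linarith+
      then have "2 powr real_of_int k \<le> \<bar>s p - s i\<bar>" "\<bar>s p - s i\<bar> < 2 powr (real_of_int k + 1)"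
        using pos by (simp_all add: le_log_iff log_less_iff)
      then show "i \<in> cls p (2 powr real_of_int k)" using i by (auto simp: cls_def powr_add)
    qed
    have "(\<Sum>i\<in>{i\<in>F. \<kappa> i = k}. measure lebesgue (hpar (R p) \<inter> hpar (R i)))
        \<le> (\<Sum>i\<in>cls p (2 powr real_of_int k). measure lebesgue (hpar (R p) \<inter> hpar (R i)))"
      by (rule sum_mono2[OF finite_cls sub]) simp
    also have "\<dots> \<le> 5 * h p / \<delta> * measure lebesgue (ann p (2 powr real_of_int k) (I p))"
      by (rule cls_overlap[OF _ p]) simp
    finally show "(\<Sum>i\<in>{i\<in>F. \<kappa> i = k}. measure lebesgue (hpar (R p) \<inter> hpar (R i)))
        \<le> 5 * h p / \<delta> * measure lebesgue (ann p (2 powr real_of_int k) (I p))" .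
  qed
  also have "\<dots> = 5 * h p / \<delta> * (\<Sum>k\<in>\<kappa> ` F. measure lebesgue (ann p (2 powr real_of_int k) (I p)))"
    by (simp add: sum_distrib_left)
  also have "\<dots> \<le> 5 * h p / \<delta> * (3 * w p)"
    using \<delta> h_pos[OF p] fF by (intro mult_left_mono sum_ann_le p) auto
  also have "\<dots> = 15 / \<delta> * measure lebesgue (hpar (R p))" by (simp add: measure_hpar valid p)
  finally show ?thesis .
qed

text \<open>Close pairs are summed with the later member fixed, far pairs with the earlier one
  fixed. Since \<open>\<delta> <= 1\<close>, ordered pairs give \<open>1 + 15 = 16\<close>, and both
  orders with the diagonal give \<open>33\<close>.\<close>

lemma total_overlap:
  "(\<Sum>i<n. \<Sum>j<n. measure lebesgue (hpar (R i) \<inter> hpar (R j)))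
    \<le> 33 / \<delta> * (\<Sum>i<n. measure lebesgue (hpar (R i)))"
proof -
  let ?m = "\<lambda>i j. measure lebesgue (hpar (R i) \<inter> hpar (R j))"
  let ?S = "\<Sum>i<n. measure lebesgue (hpar (R i))"
  define A where "A i j = (if j < i then ?m j i else 0)" for i j
  define B where "B i j = (if j < i \<and> close j i then ?m j i else 0)" for i j
  define D where "D i j = (if j < i \<and> \<not> close j i then ?m j i else 0)" for i j
  have S: "0 \<le> ?S" by (simp add: sum_nonneg)
  have SB: "(\<Sum>i<n. \<Sum>j<n. B i j) \<le> ?S"
  proof (rule sum_mono)
    fix i assume "i \<in> {..<n}"
    then have i: "i < n" by simp
    have "(\<Sum>j<n. B i j) = (\<Sum>j | j < i \<and> close j i. ?m j i)"
      unfolding B_def using i by (subst sum.inter_filter[symmetric]) (auto intro!: sum.cong)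
    then show "(\<Sum>j<n. B i j) \<le> measure lebesgue (hpar (R i))" using close_overlap[OF i] by simp
  qed
  have SD: "(\<Sum>i<n. \<Sum>j<n. D i j) \<le> 15 / \<delta> * ?S"
    unfolding sum_distrib_left
  proof (subst sum.swap, rule sum_mono)
    fix j assume "j \<in> {..<n}"
    then have j: "j < n" by simp
    have "(\<Sum>i<n. D i j) = (\<Sum>i | j < i \<and> i < n \<and> \<not> close j i. ?m j i)"
      unfolding D_def by (subst sum.inter_filter[symmetric]) (auto intro!: sum.cong)
    then show "(\<Sum>i<n. D i j) \<le> 15 / \<delta> * measure lebesgue (hpar (R j))" using far_overlap[OF j] by simp
  qed
  have "(\<Sum>i<n. \<Sum>j<n. A i j) = (\<Sum>i<n. \<Sum>j<n. B i j) + (\<Sum>i<n. \<Sum>j<n. D i j)"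
    by (simp add: sum.distrib[symmetric]) (auto simp: A_def B_def D_def intro!: sum.cong)
  also have "\<dots> \<le> 16 / \<delta> * ?S"
  proof -
    have "1 \<le> 1 / \<delta>" using \<delta> by simp
    from mult_right_mono[OF this S] have "?S \<le> 1 / \<delta> * ?S" by simp
    then have "(\<Sum>i<n. \<Sum>j<n. B i j) + (\<Sum>i<n. \<Sum>j<n. D i j) \<le> 1 / \<delta> * ?S + 15 / \<delta> * ?S" using SB SD by linarith
    then show ?thesis by (simp add: field_simps)
  qed
  finally have SA: "(\<Sum>i<n. \<Sum>j<n. A i j) \<le> 16 / \<delta> * ?S" .
  have SA': "(\<Sum>i<n. \<Sum>j<n. A j i) \<le> 16 / \<delta> * ?S" by (subst sum.swap) (rule SA)
  have "(\<Sum>i<n. \<Sum>j<n. ?m i j) = (\<Sum>i<n. \<Sum>j<n. (if j = i then ?m i i else 0) + A i j + A j i)"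
    by (intro sum.cong refl) (auto simp: A_def Int_commute)
  also have "\<dots> = ?S + (\<Sum>i<n. \<Sum>j<n. A i j) + (\<Sum>i<n. \<Sum>j<n. A j i)"
    by (simp add: sum.distrib)
  also have "\<dots> \<le> ?S + 16 / \<delta> * ?S + 16 / \<delta> * ?S" using SA SA' by linarith
  also have "\<dots> \<le> 33 / \<delta> * ?S"
  proof -
    have "1 \<le> 1 / \<delta>" using \<delta> by simp
    from mult_right_mono[OF this S] have "?S \<le> 1 / \<delta> * ?S" by simp
    then show ?thesis by (simp add: field_simps)
  qed
  finally show ?thesis .
qed

end

section \<open>The covering estimate\<close>

text \<open>Up to the right edge, \<open>Eset u p\<close> lies in the strip above the set
  \<open>F\<close> of abscissae with a good direction, so the claim follows on dividing by the
  height.\<close>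

lemma directions_dense:
  assumes p: "valid_vpar p" and u: "u \<in> borel_measurable lebesgue" and \<delta>: "0 < \<delta>"
    and E: "\<delta> * measure lebesgue (par_set p) \<le> measure lebesgue (Eset u p)"
  shows "\<delta> * wid p \<le> measure lebesgue {x \<in> base p. \<bar>u x - pslope p\<bar> \<le> pheight p / wid p}"
proof -
  note v = valid_vparD[OF p]
  define F where "F = {x \<in> base p. \<bar>u x - pslope p\<bar> \<le> pheight p / wid p}"
  have [measurable]: "u \<in> borel_measurable lebesgue" by (rule u)
  have "{x \<in> space lebesgue. \<bar>u x - pslope p\<bar> \<le> pheight p / wid p} \<in> sets lebesgue" by measurable
  moreover have "base p \<in> sets lebesgue" by simp
  ultimately have "base p \<inter> {x \<in> space lebesgue. \<bar>u x - pslope p\<bar> \<le> pheight p / wid p} \<in> sets lebesgue"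
    by (rule sets.Int[rotated])
  then have F: "F \<in> sets lebesgue" by (simp add: F_def Int_def)
  then obtain S N N' where SN: "F = S \<union> N" "N \<subseteq> N'" "N' \<in> null_sets lborel" "S \<in> sets lborel"
    by (rule sets_completionE)
  have Fb: "F \<subseteq> base p" by (auto simp: F_def)
  have Fm: "F \<in> lmeasurable"
    by (rule fmeasurableI2[OF _ Fb F]) (simp add: fmeasurable_def)
  \<comment> \<open>\<open>u\<close> is only Lebesgue measurable, while strips are measured over
    Borel sets, so \<open>F\<close> is enlarged by a null set to a Borel set. The point
    \<open>pb p\<close> is added because the closed parallelogram reaches it and the half-open base
    does not.\<close>
  define G where "G = S \<union> (N' \<union> {pb p})"
  have "{pb p} \<in> null_sets lborel" by (simp add: null_sets_def)
  then have "N' \<union> {pb p} \<in> null_sets lborel" using SN(3) by (rule null_sets.Un[rotated])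
  then have eG: "emeasure lborel G = emeasure lborel S" and "G \<in> sets lborel"
    unfolding G_def using SN(4) by (rule emeasure_Un_null_set[rotated], rule sets.Un[rotated, OF null_setsD2])
  then have GB: "G \<in> sets borel" by simp
  have "emeasure lborel S = emeasure lebesgue S" using SN(4) by simp
  also have "\<dots> \<le> emeasure lebesgue F" using SN(1) F by (intro emeasure_mono) auto
  finally have eSF: "emeasure lborel S \<le> emeasure lebesgue F" .
  also have "\<dots> < top" using fmeasurableD2[OF Fm] by (simp add: less_top)
  finally have fin: "emeasure lborel G < \<infinity>" using eG by simp
  have mGF: "measure lborel G \<le> measure lebesgue F"
    using eSF eG fmeasurableD2[OF Fm] by (simp add: measure_def enn2real_mono less_top)
  let ?Q = "strip G (pslope p) (pint p) (pheight p)"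
  have "Eset u p \<subseteq> ?Q"
  proof
    fix z assume "z \<in> Eset u p"
    then obtain x y where z: "z = (x, y)" "(x, y) \<in> par_set p" "u x \<in> Uset p" by (auto simp: Eset_def)
    have "\<bar>u x - pslope p\<bar> \<le> pheight p / wid p" by (rule Uset_bound[OF p z(3)])
    then have "x \<in> F \<or> x = pb p" using z(2) by (auto simp: F_def par_set_def base_def)
    then have "x \<in> G" using SN by (auto simp: G_def)
    then show "z \<in> ?Q" using z by (auto simp: strip_def par_set_def)
  qed
  \<comment> \<open>A non-measurable set has \<open>measure\<close> zero by convention, so the
    density hypothesis itself forces \<open>Eset u p\<close> to be measurable.\<close>
  moreover have "0 < \<delta> * measure lebesgue (par_set p)" using \<delta> v by (simp add: measure_par_set p)
  then have "Eset u p \<in> sets lebesgue" using E measure_notin_sets[of "Eset u p" lebesgue] by fastforce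
  ultimately have "measure lebesgue (Eset u p) \<le> measure lebesgue ?Q"
    using v by (intro measure_mono_fmeasurable lmeasurable_strip GB fin) auto
  also have "\<dots> = measure lborel G * pheight p" using v GB fin by (intro measure_strip) auto
  also have "\<dots> \<le> measure lebesgue F * pheight p" using mGF v by (intro mult_right_mono) auto
  finally have "\<delta> * wid p * pheight p \<le> measure lebesgue F * pheight p"
    using E by (simp add: measure_par_set p mult_ac)
  then show ?thesis using v unfolding F_def by simp
qed

text \<open>By the density, \<open>\<sigma>\<close> times the sum of the measures is at most the
  integral over \<open>H\<close> of the multiplicity function. The overlap hypothesis bounds the
  second moment of that function, so the sets cannot crowd into a small \<open>H\<close>.\<close>

lemma sum_measure_le_of_overlap:
  fixes A :: "nat \<Rightarrow> 'a::euclidean_space set"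
  assumes A: "\<And>i. i < n \<Longrightarrow> A i \<in> lmeasurable" and H: "H \<in> lmeasurable"
    and \<sigma>: "0 < \<sigma>" and dens: "\<And>i. i < n \<Longrightarrow> \<sigma> * measure lebesgue (A i) \<le> measure lebesgue (H \<inter> A i)"
    and K: "0 < K" and ov: "(\<Sum>i<n. \<Sum>j<n. measure lebesgue (A i \<inter> A j)) \<le> K * (\<Sum>i<n. measure lebesgue (A i))"
  shows "(\<Sum>i<n. measure lebesgue (A i)) \<le> K / \<sigma>\<^sup>2 * measure lebesgue H"
proof -
  define S where "S = (\<Sum>i<n. measure lebesgue (A i))"
  \<comment> \<open>With this choice the quadratic term is at most \<open>\<sigma> * S / 2\<close>,
    which the left-hand side absorbs.\<close>
  define t where "t = K / \<sigma>"
  have t: "t > 0" using K \<sigma> by (simp add: t_def)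
  let ?N = "\<lambda>x. \<Sum>i<n. indicator (A i) x :: real"
  have AA: "A i \<inter> A j \<in> lmeasurable" if "i < n" "j < n" for i j using A that by (intro fmeasurable.Int) auto
  have HA: "H \<inter> A i \<in> lmeasurable" if "i < n" for i using A H that by (intro fmeasurable.Int) auto
  text \<open>AM-GM pointwise in place of Cauchy-Schwarz: \<open>N \<le> t / 2 + N\<^sup>2 / (2 * t)\<close> on \<open>H\<close>.\<close>
  have pt: "(\<Sum>i<n. indicator (H \<inter> A i) x) \<le>
      t / 2 * indicator H x + 1 / (2 * t) * (\<Sum>i<n. \<Sum>j<n. indicator (A i \<inter> A j) x)" for x
  proof -
    have sq: "(\<Sum>i<n. \<Sum>j<n. indicator (A i \<inter> A j) x) = (?N x)\<^sup>2"
      by (simp add: power2_eq_square sum_product indicator_inter_arith)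
    have "0 \<le> (t - ?N x)\<^sup>2" by simp
    then have "?N x \<le> t / 2 + 1 / (2 * t) * (?N x)\<^sup>2"
      using t by (simp add: field_simps power2_eq_square)
    then show ?thesis unfolding sq using t by (cases "x \<in> H") (simp_all add: indicator_inter_arith)
  qed
  have "\<sigma> * S \<le> (\<Sum>i<n. measure lebesgue (H \<inter> A i))"
    unfolding S_def sum_distrib_left by (intro sum_mono dens) simp
  also have "\<dots> = (\<Sum>i<n. \<integral>x. indicator (H \<inter> A i) x \<partial>lebesgue)" by simp
  also have "\<dots> = (\<integral>x. (\<Sum>i<n. indicator (H \<inter> A i) x) \<partial>lebesgue)"
    using HA by (intro Bochner_Integration.integral_sum[symmetric]) (simp add: lmeasurable_iff_integrable)
  also have "\<dots> \<le> (\<integral>x. t / 2 * indicator H x + 1 / (2 * t) * (\<Sum>i<n. \<Sum>j<n. indicator (A i \<inter> A j) x) \<partial>lebesgue)"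
    using HA AA H
    by (intro integral_mono pt Bochner_Integration.integrable_sum Bochner_Integration.integrable_add
        integrable_mult_right) (auto simp: lmeasurable_iff_integrable)
  also have "\<dots> = t / 2 * measure lebesgue H + 1 / (2 * t) * (\<Sum>i<n. \<Sum>j<n. measure lebesgue (A i \<inter> A j))"
  proof -
    let ?Q = "\<lambda>x. \<Sum>i<n. \<Sum>j<n. indicator (A i \<inter> A j) x :: real"
    have i2: "integrable lebesgue (\<lambda>x. \<Sum>j<n. indicator (A i \<inter> A j) x :: real)" if "i < n" for i
      using AA[OF that] by (intro Bochner_Integration.integrable_sum) (simp add: lmeasurable_iff_integrable)
    then have "integrable lebesgue ?Q" by (rule Bochner_Integration.integrable_sum) simp
    moreover have "integrable lebesgue (indicator H :: 'a \<Rightarrow> real)" using H by (simp add: lmeasurable_iff_integrable)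
    ultimately have "(\<integral>x. t / 2 * indicator H x + 1 / (2 * t) * ?Q x \<partial>lebesgue)
        = (\<integral>x. t / 2 * indicator H x \<partial>lebesgue) + (\<integral>x. 1 / (2 * t) * ?Q x \<partial>lebesgue)"
      by (intro Bochner_Integration.integral_add integrable_mult_right) auto
    also have "\<dots> = t / 2 * measure lebesgue H + 1 / (2 * t) * (\<integral>x. ?Q x \<partial>lebesgue)"
      by (simp only: integral_mult_right_zero) simp
    also have "(\<integral>x. ?Q x \<partial>lebesgue) = (\<Sum>i<n. \<integral>x. (\<Sum>j<n. indicator (A i \<inter> A j) x) \<partial>lebesgue)"
      using i2 by (intro Bochner_Integration.integral_sum) simp
    also have "\<dots> = (\<Sum>i<n. \<Sum>j<n. measure lebesgue (A i \<inter> A j))"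
      using AA by (intro sum.cong refl, subst Bochner_Integration.integral_sum) (auto simp: lmeasurable_iff_integrable)
    finally show ?thesis .
  qed
  also have "\<dots> \<le> t / 2 * measure lebesgue H + 1 / (2 * t) * (K * S)"
    using ov t unfolding S_def by (intro add_left_mono mult_left_mono) auto
  also have "1 / (2 * t) * (K * S) = \<sigma> * S / 2" using K \<sigma> by (simp add: t_def)
  finally have "\<sigma> * S \<le> t * measure lebesgue H" by simp
  then have "S \<le> t / \<sigma> * measure lebesgue H" using \<sigma> by (simp add: field_simps)
  then show ?thesis unfolding S_def t_def by (simp add: power2_eq_square)
qed

theorem theorem3p3:
  "\<exists>C>0. \<forall>(\<delta>::real) (\<sigma>::real) (H::(real \<times> real) set) (u::real \<Rightarrow> real)
      (\<R>::vpar set) (c::int \<Rightarrow> real).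
     0 < \<delta> \<and> \<delta> \<le> 1 \<and> 0 < \<sigma> \<and> \<sigma> \<le> 1 \<and>
     H \<in> sets lebesgue \<and> u \<in> borel_measurable lebesgue \<and>
     finite \<R> \<and> dyadic_grid c \<and>
     (\<forall>R\<in>\<R>. valid_vpar R \<and> shadow_in_grid c R \<and>
        measure lebesgue (Eset u R) \<ge> \<delta> * measure lebesgue (par_set R) \<and>
        measure lebesgue (H \<inter> par_set R) \<ge> \<sigma> * measure lebesgue (par_set R))
     \<longrightarrow> emeasure lebesgue (\<Union>R\<in>\<R>. par_set R)
           \<le> ennreal (C / (\<delta> * \<sigma>\<^sup>2)) * emeasure lebesgue H"
proof (intro exI[of _ 3300] conjI allI impI)
  fix \<delta> \<sigma> :: real and H :: "(real \<times> real) set" and u :: "real \<Rightarrow> real" and \<R> :: "vpar set"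
    and c :: "int \<Rightarrow> real"
  assume as: "0 < \<delta> \<and> \<delta> \<le> 1 \<and> 0 < \<sigma> \<and> \<sigma> \<le> 1 \<and>
     H \<in> sets lebesgue \<and> u \<in> borel_measurable lebesgue \<and>
     finite \<R> \<and> dyadic_grid c \<and>
     (\<forall>R\<in>\<R>. valid_vpar R \<and> shadow_in_grid c R \<and>
        measure lebesgue (Eset u R) \<ge> \<delta> * measure lebesgue (par_set R) \<and>
        measure lebesgue (H \<inter> par_set R) \<ge> \<sigma> * measure lebesgue (par_set R))"
  show "emeasure lebesgue (\<Union>R\<in>\<R>. par_set R) \<le> ennreal (3300 / (\<delta> * \<sigma>\<^sup>2)) * emeasure lebesgue H"
  proof (cases "emeasure lebesgue H = \<infinity>")
    case True
    then show ?thesis using as by (simp add: ennreal_mult_top)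
  next
    case False
    then have H: "H \<in> lmeasurable" using as by (simp add: fmeasurable_def less_top)
    obtain gs where gs: "set gs \<subseteq> \<R>" "sorted_wrt (\<lambda>p q. wid q \<le> wid p) gs"
      "\<And>i. i < length gs \<Longrightarrow> \<exists>x y. (x, y) \<in> hpar (gs ! i) \<and> sparse_at gs i x y"
      "\<And>p x y. p \<in> \<R> \<Longrightarrow> (x, y) \<in> hpar p \<Longrightarrow> \<not> sparse_at gs (length gs) x y"
      using greedy_selection[of \<R>] as by auto
    define n where "n = length gs"
    have mem: "gs ! i \<in> \<R>" if "i < n" for i using gs(1) that nth_mem n_def by blast
    interpret directed_family c gs n u \<delta>
    proof
      show "dyadic_grid c" "u \<in> borel_measurable lebesgue" "0 < \<delta>" "\<delta> \<le> 1" using as by auto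
      fix i assume i: "i < n"
      show "valid_vpar (gs ! i)" "shadow_in_grid c (gs ! i)" using as mem[OF i] by auto
      show "\<exists>x y. (x, y) \<in> hpar (gs ! i) \<and> sparse_at gs i x y" using gs(3) i n_def by simp
      show "\<delta> * wid (gs ! i) \<le> measure lebesgue {x \<in> base (gs ! i). \<bar>u x - pslope (gs ! i)\<bar>
          \<le> pheight (gs ! i) / wid (gs ! i)}"
        using as mem[OF i] by (intro directions_dense) auto
    next
      fix i j assume "i \<le> j" "j < n"
      then show "wid (gs ! j) \<le> wid (gs ! i)"
        using sorted_wrt_nth_less[OF gs(2), of i j] n_def by (cases "i = j") auto
    qed
    \<comment> \<open>Passing to the half-open parallelogram costs only a null set, so the density
      of \<open>H\<close> is unchanged.\<close>
    have Hd: "\<sigma> * measure lebesgue (hpar (gs ! i)) \<le> measure lebesgue (H \<inter> hpar (gs ! i))" if i: "i < n" for i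
    proof -
      have "measure lebesgue (H \<inter> par_set (gs ! i)) = measure lebesgue (H \<inter> hpar (gs ! i))"
      proof (rule measure_eq_AE)
        have "AE x in lebesgue. x \<notin> par_set (gs ! i) - hpar (gs ! i)"
          using par_set_Diff_hpar_null[OF valid[OF i]] by (rule AE_not_in)
        then show "AE x in lebesgue. (x \<in> H \<inter> par_set (gs ! i)) = (x \<in> H \<inter> hpar (gs ! i))"
          using hpar_subset_par_set by (auto elim!: eventually_mono)
        show "H \<inter> par_set (gs ! i) \<in> sets lebesgue" "H \<inter> hpar (gs ! i) \<in> sets lebesgue"
          using H par_set_lmeasurable[OF valid[OF i]] hpar_lmeasurable[OF valid[OF i]] by auto
      qed
      moreover have "\<sigma> * measure lebesgue (par_set (gs ! i)) \<le> measure lebesgue (H \<inter> par_set (gs ! i))"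
        using as mem[OF i] by blast
      ultimately show ?thesis by (simp add: measure_hpar measure_par_set valid[OF i])
    qed
    have "(\<Sum>i<n. measure lebesgue (hpar (gs ! i))) \<le> 33 / \<delta> / \<sigma>\<^sup>2 * measure lebesgue H"
      using as by (intro sum_measure_le_of_overlap H Hd total_overlap hpar_lmeasurable valid) auto
    \<comment> \<open>\<open>3300\<close> is \<open>100\<close> from the weak type bound times
      \<open>33\<close> from the total overlap.\<close>
    then have le: "100 * (\<Sum>i<n. measure lebesgue (hpar (gs ! i))) \<le> 3300 / (\<delta> * \<sigma>\<^sup>2) * measure lebesgue H"
      by simp
    have "emeasure lebesgue (\<Union>R\<in>\<R>. par_set R) \<le> ennreal (100 * (\<Sum>i<n. measure lebesgue (hpar (gs ! i))))"
      unfolding n_def using as gs by (intro weak_type) auto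
    also have "\<dots> \<le> ennreal (3300 / (\<delta> * \<sigma>\<^sup>2) * measure lebesgue H)" by (rule ennreal_leI[OF le])
    also have "\<dots> = ennreal (3300 / (\<delta> * \<sigma>\<^sup>2)) * emeasure lebesgue H"
      using as emeasure_eq_measure2[OF H] by (subst ennreal_mult) auto
    finally show ?thesis .
  qed
qed simp

end
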